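(* Fix $\theta\ge0$, $M>0$, $\alpha\in(0,1)$ and a constant $c>0$, and let $\varrho_n=c\,n^{-\frac{2s(\theta+1)}{4s+\theta+1}}$. Let $T_{\mathrm{M^3d}}$ be the test that rejects $H_0:P=P_0$ iff $(2v_n)^{-1/2}\big[n\eta^2_{\varrho_n}(\widehat P_n,P_0)-A_n\big]>z_{1-\alpha}$, where $z_{1-\alpha}$ is the $1-\alpha$ quantile of the standard normal. If $n^{\frac{4s}{4s+\theta+1}}\Delta_n\to\infty$, then $\beta(T_{\mathrm{M^3d}};\Delta_n,\theta,M)\to0$ as $n\to\infty$.
   Context: Standing setup. $(\mathcal X,\mathcal B)$ is a measurable space and $P_0$ a known probability measure on it. $K$ is a symmetric, positive semidefinite, square-integrable kernel, degenerate under $P_0$, with Mercer decomposition $K(x,x')=\sum_{k\ge1}\lambda_k\varphi_k(x)\varphi_k(x')$, infinitely many eigenvalues $\lambda_1>\lambda_2>\cdots>0$, $\{\varphi_k\}$ an orthonormal basis of the $P_0$-mean-zero functions in $L_2(P_0)$, $0<\liminf_k k^{2s}\lambda_k\le\limsup_k k^{2s}\lambda_k<\infty$ for some $s>1/2$, and $\sup_k\|\varphi_k\|_\infty<\infty$. $\mathcal H(K)$ is the RKHS of $K$, $\|f\|_K^2=\sum_k\lambda_k^{-1}\langle f,\varphi_k\rangle_{L_2(P_0)}^2$. $\mathcal F(\theta;M)$ ($\theta>0$) is the set of $f\in L_2(P_0)$ such that for every $R>0$ there is $f_R\in\mathcal H(K)$ with $\|f_R\|_K\le R$ and $\|f-f_R\|_{L_2(P_0)}\le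 MR^{-1/\theta}$; $\mathcal F(0;M)=\{f\in\mathcal H(K):\|f\|_K\le M\}$. $\mathcal P(\Delta,\theta,M)$ is the set of probability measures $P\ll P_0$ with $u=dP/dP_0-1\in\mathcal F(\theta;M)$ and $\|u\|^2_{L_2(P_0)}\ge\Delta$. Type II error: $\beta(T;\Delta,\theta,M)=\sup_{P\in\mathcal P(\Delta,\theta,M)}\mathbb E_P[1-T(X_1,\dots,X_n)]$, $X_i$ i.i.d. $P$. $\tilde K_\varrho(x,x')=\sum_k\frac{\lambda_k}{\lambda_k+\varrho^2}\varphi_k(x)\varphi_k(x')$; $\eta^2_\varrho(\widehat P_n,P_0)=\sum_k\frac{\lambda_k}{\lambda_k+\varrho^2}\big[\frac1n\sum_i\varphi_k(X_i)\big]^2$; $v_n=\sum_k\big(\frac{\lambda_k}{\lambda_k+\varrho_n^2}\big)^2$; $A_n=\frac1n\sum_i\tilde K_{\varrho_n}(X_i,X_i)$. *)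

theory Defs
  imports "HOL-Probability.Probability"
begin

text \<open>Eigen-data: eigenvalues lam k and eigenfunctions phi k, indexed from 0
  (index k here corresponds to index k+1 in the paper).\<close>

definition L2 :: "'a measure \<Rightarrow> ('a \<Rightarrow> real) set" where
  "L2 P0 = {f. f \<in> borel_measurable P0 \<and> integrable P0 (\<lambda>x. (f x)\<^sup>2)}"

definition L2_inner :: "'a measure \<Rightarrow> ('a \<Rightarrow> real) \<Rightarrow> ('a \<Rightarrow> real) \<Rightarrow> real" where
  "L2_inner P0 f g = (\<integral>x. f x * g x \<partial>P0)"

definition L2_norm :: "'a measure \<Rightarrow> ('a \<Rightarrow> real) \<Rightarrow> real" where
  "L2_norm P0 f = sqrt (\<integral>x. (f x)\<^sup>2 \<partial>P0)"

definition mercer_setup ::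
  "'a measure \<Rightarrow> ('a \<Rightarrow> 'a \<Rightarrow> real) \<Rightarrow> (nat \<Rightarrow> real) \<Rightarrow> (nat \<Rightarrow> 'a \<Rightarrow> real) \<Rightarrow> real \<Rightarrow> bool" where
  "mercer_setup P0 K lam phi s \<longleftrightarrow>
     prob_space P0 \<and> s > 1/2 \<and>
     (\<forall>x\<in>space P0. \<forall>x'\<in>space P0. K x x' = (\<Sum>k. lam k * phi k x * phi k x')) \<and>
     (\<forall>k. lam k > 0 \<and> lam (Suc k) < lam k) \<and>
     0 < Liminf sequentially (\<lambda>k. ereal (real (Suc k) powr (2 * s) * lam k)) \<and>
     Limsup sequentially (\<lambda>k. ereal (real (Suc k) powr (2 * s) * lam k)) < \<infinity> \<and>
     (\<forall>k. phi k \<in> L2 P0 \<and> (\<integral>x. phi k x \<partial>P0) = 0) \<and>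
     (\<forall>j k. L2_inner P0 (phi j) (phi k) = (if j = k then 1 else 0)) \<and>
     (\<forall>f\<in>L2 P0. (\<integral>x. f x \<partial>P0) = 0 \<longrightarrow> (\<forall>k. L2_inner P0 f (phi k) = 0)
        \<longrightarrow> (AE x in P0. f x = 0)) \<and>
     (\<exists>B. \<forall>k. \<forall>x\<in>space P0. \<bar>phi k x\<bar> \<le> B)"

definition in_RKHS :: "'a measure \<Rightarrow> (nat \<Rightarrow> real) \<Rightarrow> (nat \<Rightarrow> 'a \<Rightarrow> real) \<Rightarrow> ('a \<Rightarrow> real) \<Rightarrow> bool" where
  "in_RKHS P0 lam phi f \<longleftrightarrow> f \<in> L2 P0 \<and> (\<integral>x. f x \<partial>P0) = 0 \<and>
     summable (\<lambda>k. (L2_inner P0 f (phi k))\<^sup>2 / lam k)"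

definition RKHS_norm :: "'a measure \<Rightarrow> (nat \<Rightarrow> real) \<Rightarrow> (nat \<Rightarrow> 'a \<Rightarrow> real) \<Rightarrow> ('a \<Rightarrow> real) \<Rightarrow> real" where
  "RKHS_norm P0 lam phi f = sqrt (\<Sum>k. (L2_inner P0 f (phi k))\<^sup>2 / lam k)"

definition Fclass :: "'a measure \<Rightarrow> (nat \<Rightarrow> real) \<Rightarrow> (nat \<Rightarrow> 'a \<Rightarrow> real) \<Rightarrow> real \<Rightarrow> real \<Rightarrow> ('a \<Rightarrow> real) set" where
  "Fclass P0 lam phi \<theta> M =
     (if \<theta> = 0 then {f. in_RKHS P0 lam phi f \<and> RKHS_norm P0 lam phi f \<le> M}
      else {f. f \<in> L2 P0 \<and> (\<forall>R>0. \<exists>fR. in_RKHS P0 lam phi fR \<and> RKHS_norm P0 lam phi fR \<le> R \<and>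
                 L2_norm P0 (\<lambda>x. f x - fR x) \<le> M * R powr (-1/\<theta>))})"

definition Pclass :: "'a measure \<Rightarrow> (nat \<Rightarrow> real) \<Rightarrow> (nat \<Rightarrow> 'a \<Rightarrow> real) \<Rightarrow> real \<Rightarrow> real \<Rightarrow> real \<Rightarrow> 'a measure set" where
  "Pclass P0 lam phi \<Delta> \<theta> M =
     {P. prob_space P \<and> sets P = sets P0 \<and> absolutely_continuous P0 P \<and>
         (let u = (\<lambda>x. enn2real (RN_deriv P0 P x) - 1) in
            u \<in> Fclass P0 lam phi \<theta> M \<and> (L2_norm P0 u)\<^sup>2 \<ge> \<Delta>)}"

definition eta2 :: "(nat \<Rightarrow> real) \<Rightarrow> (nat \<Rightarrow> 'a \<Rightarrow> real) \<Rightarrow> real \<Rightarrow> nat \<Rightarrow> (nat \<Rightarrow> 'a) \<Rightarrow> real" where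
  "eta2 lam phi \<rho> n X = (\<Sum>k. lam k / (lam k + \<rho>\<^sup>2) * ((1 / real n) * (\<Sum>i<n. phi k (X i)))\<^sup>2)"

definition v_n :: "(nat \<Rightarrow> real) \<Rightarrow> real \<Rightarrow> real" where
  "v_n lam \<rho> = (\<Sum>k. (lam k / (lam k + \<rho>\<^sup>2))\<^sup>2)"

definition Ktilde :: "(nat \<Rightarrow> real) \<Rightarrow> (nat \<Rightarrow> 'a \<Rightarrow> real) \<Rightarrow> real \<Rightarrow> 'a \<Rightarrow> 'a \<Rightarrow> real" where
  "Ktilde lam phi \<rho> x x' = (\<Sum>k. lam k / (lam k + \<rho>\<^sup>2) * phi k x * phi k x')"

definition A_n :: "(nat \<Rightarrow> real) \<Rightarrow> (nat \<Rightarrow> 'a \<Rightarrow> real) \<Rightarrow> real \<Rightarrow> nat \<Rightarrow> (nat \<Rightarrow> 'a) \<Rightarrow> real" where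
  "A_n lam phi \<rho> n X = (1 / real n) * (\<Sum>i<n. Ktilde lam phi \<rho> (X i) (X i))"

definition std_normal_quantile :: "real \<Rightarrow> real" where
  "std_normal_quantile p = (THE z. (\<integral>t. indicator {..z} t * std_normal_density t \<partial>lborel) = p)"

text \<open>The M^3d test: 1 = reject H0, 0 = accept.\<close>
definition T_M3d :: "(nat \<Rightarrow> real) \<Rightarrow> (nat \<Rightarrow> 'a \<Rightarrow> real) \<Rightarrow> real \<Rightarrow> real \<Rightarrow> nat \<Rightarrow> (nat \<Rightarrow> 'a) \<Rightarrow> real" where
  "T_M3d lam phi \<rho> \<alpha> n X =
     (if (1 / sqrt (2 * v_n lam \<rho>)) * (real n * eta2 lam phi \<rho> n X - A_n lam phi \<rho> n X)
           > std_normal_quantile (1 - \<alpha>) then 1 else 0)"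

definition typeII ::
  "'a measure \<Rightarrow> (nat \<Rightarrow> real) \<Rightarrow> (nat \<Rightarrow> 'a \<Rightarrow> real) \<Rightarrow> nat \<Rightarrow> ((nat \<Rightarrow> 'a) \<Rightarrow> real)
     \<Rightarrow> real \<Rightarrow> real \<Rightarrow> real \<Rightarrow> real" where
  "typeII P0 lam phi n T \<Delta> \<theta> M =
     (if Pclass P0 lam phi \<Delta> \<theta> M = {} then 0
      else (SUP P\<in>Pclass P0 lam phi \<Delta> \<theta> M. \<integral>X. 1 - T X \<partial>(PiM {..<n} (\<lambda>_. P))))"

end

theory Submission
  imports Defs
begin

text \<open>
  The statistic is \<open>2/n\<close> times the U-statistic of \<open>\<Sum>k. w k * phi k x * phi k y\<close> with
  \<open>w k = lam k / (lam k + \<rho>\<^sup>2)\<close>. Under the alternative with density \<open>1 + u\<close> its mean is about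
  \<open>n * \<mu>\<close>, \<open>\<mu> = \<Sum>k. w k * \<langle>u, phi k\<rangle>\<^sup>2\<close>, and approximating \<open>u\<close> by an RKHS function of suitable
  norm gives \<open>\<mu> \<ge> \<parallel>u\<parallel>\<^sup>2 / 8\<close> once \<open>\<rho>\<close> is small against \<open>\<parallel>u\<parallel> powr (\<theta> + 1)\<close>. The variance is controlled by
  the Hoeffding decomposition: with \<open>S = \<Sum>k. w k\<close>, Bessel's inequality for \<open>phi k * u\<close> bounds the
  second moment of the kernel by a multiple of \<open>S * (1 + \<parallel>u\<parallel>\<^sup>2)\<close>, and that of its projection by
  a multiple of \<open>\<mu> * (1 + sqrt S * \<parallel>u\<parallel>)\<close>. Since \<open>S\<close> is of order at most \<open>\<rho> powr (-1/s)\<close> and the normalizer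
  \<open>v_n\<close> is at most \<open>S\<close>, Chebyshev's inequality concludes.
\<close>

subsection \<open>Second moment of a U-statistic\<close>

text \<open>No limit law enters: the normal quantile is a fixed number, so it is enough that the
  mean lies far beyond the threshold, measured in standard deviations and uniformly over the class.
  The obstacle is that \<open>u\<close> is only square integrable. Moments under the alternative
  cannot be compared with those under \<open>P0\<close> through a bound on the density, so the
  uniformly bounded \<open>phi k\<close> carry the estimates, and the norm of \<open>u\<close> stays
  explicit until it is divided by the squared mean. The rates balance as follows. Put
  \<open>E = 4 * s + \<theta> + 1\<close> and \<open>r = n powr ((\<theta> + 1) / E)\<close>. The
  chosen \<open>\<rho>\<close> makes \<open>sqrt S\<close> at most of order \<open>r\<close>, and
  \<open>\<rho>\<^sup>2\<close> a multiple of
  \<open>n powr (- (4 * s / E) * (\<theta> + 1))\<close>. Since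
  \<open>4 * s / E = 1 - (\<theta> + 1) / E\<close>, the diverging quantity
  \<open>n powr (4 * s / E) * \<Delta>\<close> is \<open>D = n * \<Delta> / r\<close>, essentially
  mean over threshold. This one number governs everything: the bias condition is a lower bound on
  \<open>D powr (\<theta> + 1)\<close>, and every variance ratio is at most a constant over a
  positive power of \<open>D\<close>.\<close>

lemma power2_le_of_abs_le:
  fixes x y :: real
  assumes "\<bar>x\<bar> \<le> y"
  shows "x\<^sup>2 \<le> y\<^sup>2"
  using power_mono[OF assms, of 2] by simp

lemma abs_power2_le:
  fixes x y :: real
  assumes "\<bar>x\<bar> \<le> y"
  shows "\<bar>x\<^sup>2\<bar> \<le> y\<^sup>2"
  using power2_le_of_abs_le[OF assms] by simp

lemma abs_sum_le_real:
  fixes a :: "nat \<Rightarrow> real"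
  assumes "\<And>i. i < n \<Longrightarrow> \<bar>a i\<bar> \<le> C"
  shows "\<bar>\<Sum>i<n. a i\<bar> \<le> real n * C"
proof -
  have "\<bar>\<Sum>i<n. a i\<bar> \<le> (\<Sum>i<n. \<bar>a i\<bar>)" by (rule sum_abs)
  also have "\<dots> \<le> real n * C"
    using sum_bounded_above[of "{..<n}" "\<lambda>i. \<bar>a i\<bar>" C] assms by simp
  finally show ?thesis .
qed

section \<open>Expectations of bounded functions and moments over i.i.d. samples\<close>

context prob_space
begin

lemma integrable_bounded:
  fixes f :: "'a \<Rightarrow> real"
  assumes "f \<in> borel_measurable M" "\<And>x. x \<in> space M \<Longrightarrow> \<bar>f x\<bar> \<le> C"
  shows "integrable M f"
  using assms by (intro integrable_const_bound[where B = C]) (auto intro!: AE_I2)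

lemma abs_expectation_le:
  fixes f :: "'a \<Rightarrow> real"
  assumes f: "f \<in> borel_measurable M" "\<And>x. x \<in> space M \<Longrightarrow> \<bar>f x\<bar> \<le> C"
  shows "\<bar>expectation f\<bar> \<le> C"
proof -
  have "\<bar>expectation f\<bar> \<le> expectation (\<lambda>x. \<bar>f x\<bar>)"
    using integral_norm_bound[of M f] by simp
  also have "\<dots> \<le> expectation (\<lambda>x. C)"
    using f(2) by (intro integral_mono integrable_abs integrable_bounded[OF f]) auto
  finally show ?thesis by (simp add: prob_space)
qed

lemma expectation_centered_power2_le:
  fixes f :: "'a \<Rightarrow> real"
  assumes f: "f \<in> borel_measurable M" "\<And>x. x \<in> space M \<Longrightarrow> \<bar>f x\<bar> \<le> C"
  shows "expectation (\<lambda>x. (f x - expectation f)\<^sup>2) \<le> expectation (\<lambda>x. (f x)\<^sup>2)"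
proof -
  have "integrable M (\<lambda>x. (f x)\<^sup>2)"
    using f by (intro integrable_bounded[where C = "C\<^sup>2"]) (auto intro: power2_le_of_abs_le)
  then show ?thesis
    using variance_eq[OF integrable_bounded[OF f]] by simp
qed

lemma integrable_pair_bounded:
  fixes f :: "'a \<Rightarrow> 'a \<Rightarrow> real"
  assumes "case_prod f \<in> borel_measurable (M \<Otimes>\<^sub>M M)"
    "\<And>x y. x \<in> space M \<Longrightarrow> y \<in> space M \<Longrightarrow> \<bar>f x y\<bar> \<le> C"
  shows "integrable (M \<Otimes>\<^sub>M M) (case_prod f)"
proof -
  interpret pair_prob_space M M ..
  show ?thesis
    using assms by (intro P.integrable_bounded[where C = C]) (auto simp: space_pair_measure)
qed

lemma expectation_swap:
  fixes f :: "'a \<Rightarrow> 'a \<Rightarrow> real"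
  assumes "case_prod f \<in> borel_measurable (M \<Otimes>\<^sub>M M)"
    "\<And>x y. x \<in> space M \<Longrightarrow> y \<in> space M \<Longrightarrow> \<bar>f x y\<bar> \<le> C"
  shows "(\<integral>y. (\<integral>x. f x y \<partial>M) \<partial>M) = (\<integral>x. (\<integral>y. f x y \<partial>M) \<partial>M)"
proof -
  note int = integrable_pair_bounded[OF assms]
  interpret pair_prob_space M M ..
  show ?thesis by (rule Fubini_integral[OF int])
qed

text \<open>Fubini for the newest observation, which has index \<open>n\<close> because samples are
  indexed by \<open>{..<n}\<close>. It drives the inductions on the sample size.\<close>

lemma expectation_iid_insert:
  fixes f :: "(nat \<Rightarrow> 'a) \<Rightarrow> real"
  assumes f: "f \<in> borel_measurable (PiM {..<Suc n} (\<lambda>_. M))"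
    "\<And>X. X \<in> space (PiM {..<Suc n} (\<lambda>_. M)) \<Longrightarrow> \<bar>f X\<bar> \<le> C"
  shows "(\<integral>X. f X \<partial>PiM {..<Suc n} (\<lambda>_. M)) = (\<integral>X. (\<integral>y. f (X(n := y)) \<partial>M) \<partial>PiM {..<n} (\<lambda>_. M))"
proof -
  interpret product_prob_space "\<lambda>_. M" "{..<n}" ..
  interpret N: prob_space "PiM {..<Suc n} (\<lambda>_. M)"
    by (intro prob_space_PiM) unfold_locales
  have "integrable (PiM (insert n {..<n}) (\<lambda>_. M)) f"
    using N.integrable_bounded[OF f] by (simp add: lessThan_Suc)
  from product_integral_insert[OF _ _ this] show ?thesis
    by (simp add: lessThan_Suc)
qed

lemma space_iidD:
  "X \<in> space (PiM {..<n} (\<lambda>_. M)) \<Longrightarrow> i < n \<Longrightarrow> X i \<in> space M"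
  by (auto simp: space_PiM PiE_iff)

text \<open>Given the earlier observations, the cross term is a multiple of \<open>q y\<close> with
  \<open>y\<close> fresh, so it integrates to zero.\<close>

lemma expectation_sum_centered_power2:
  fixes q :: "'a \<Rightarrow> real"
  assumes q[measurable]: "q \<in> borel_measurable M"
    and bnd: "\<And>x. x \<in> space M \<Longrightarrow> \<bar>q x\<bar> \<le> C"
    and mean: "expectation q = 0"
  shows "(\<integral>X. (\<Sum>i<n. q (X i))\<^sup>2 \<partial>PiM {..<n} (\<lambda>_. M)) = real n * expectation (\<lambda>x. (q x)\<^sup>2)"
proof (induction n)
  case 0
  show ?case by simp
next
  case (Suc n)
  interpret N: prob_space "PiM {..<n} (\<lambda>_. M)"
    by (intro prob_space_PiM) unfold_locales
  have bS: "\<bar>\<Sum>i<m. q (X i)\<bar> \<le> real m * C" if "X \<in> space (PiM {..<m} (\<lambda>_. M))" for X m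
    using that by (intro abs_sum_le_real bnd space_iidD)
  have [measurable]: "(\<lambda>X. \<Sum>i<m. q (X i)) \<in> borel_measurable (PiM {..<m} (\<lambda>_. M))" for m
    by measurable
  have iq: "integrable M q" by (rule integrable_bounded[OF q bnd])
  have iq2: "integrable M (\<lambda>x. (q x)\<^sup>2)"
    by (intro integrable_bounded[where C = "C\<^sup>2"]) (auto intro: power2_le_of_abs_le bnd)
  have "(\<integral>X. (\<Sum>i<Suc n. q (X i))\<^sup>2 \<partial>PiM {..<Suc n} (\<lambda>_. M)) =
        (\<integral>X. (\<integral>y. (\<Sum>i<Suc n. q ((X(n := y)) i))\<^sup>2 \<partial>M) \<partial>PiM {..<n} (\<lambda>_. M))"
    by (intro expectation_iid_insert[where C = "(real (Suc n) * C)\<^sup>2"] abs_power2_le bS)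
        (auto simp del: sum.lessThan_Suc of_nat_Suc)
  also have "\<dots> = (\<integral>X. (\<Sum>i<n. q (X i))\<^sup>2 + expectation (\<lambda>x. (q x)\<^sup>2) \<partial>PiM {..<n} (\<lambda>_. M))"
  proof (intro Bochner_Integration.integral_cong refl)
    fix X assume "X \<in> space (PiM {..<n} (\<lambda>_. M))"
    have "(\<integral>y. (\<Sum>i<Suc n. q ((X(n := y)) i))\<^sup>2 \<partial>M) =
        (\<integral>y. (\<Sum>i<n. q (X i))\<^sup>2 + 2 * (\<Sum>i<n. q (X i)) * q y + (q y)\<^sup>2 \<partial>M)"
      by (simp add: power2_sum algebra_simps)
    also have "\<dots> = (\<Sum>i<n. q (X i))\<^sup>2 + 2 * (\<Sum>i<n. q (X i)) * expectation q + expectation (\<lambda>x. (q x)\<^sup>2)"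
      using iq iq2 by (simp add: prob_space)
    finally show "(\<integral>y. (\<Sum>i<Suc n. q ((X(n := y)) i))\<^sup>2 \<partial>M) =
        (\<Sum>i<n. q (X i))\<^sup>2 + expectation (\<lambda>x. (q x)\<^sup>2)"
      using mean by simp
  qed
  also have "\<dots> = (\<integral>X. (\<Sum>i<n. q (X i))\<^sup>2 \<partial>PiM {..<n} (\<lambda>_. M)) + expectation (\<lambda>x. (q x)\<^sup>2)"
  proof -
    have "integrable (PiM {..<n} (\<lambda>_. M)) (\<lambda>X. (\<Sum>i<n. q (X i))\<^sup>2)"
      by (intro N.integrable_bounded[where C = "(real n * C)\<^sup>2"] abs_power2_le bS) auto
    then show ?thesis by (simp add: N.prob_space)
  qed
  finally show ?case using Suc.IH by (simp add: algebra_simps)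
qed

text \<open>The new observation \<open>y\<close> adds \<open>L X y\<close>, the sum of
  \<open>h y (X j)\<close> over the old ones. By \<open>deg2\<close> this has mean zero in
  \<open>y\<close>, so the increments are orthogonal, and the increment at sample size
  \<open>n\<close> contributes \<open>n\<close> times the second moment of \<open>h\<close>.\<close>

lemma expectation_degenerate_U_statistic_power2:
  fixes h :: "'a \<Rightarrow> 'a \<Rightarrow> real"
  assumes h[measurable]: "case_prod h \<in> borel_measurable (M \<Otimes>\<^sub>M M)"
    and bnd: "\<And>x y. x \<in> space M \<Longrightarrow> y \<in> space M \<Longrightarrow> \<bar>h x y\<bar> \<le> C"
    and deg1: "\<And>x. x \<in> space M \<Longrightarrow> (\<integral>y. h x y \<partial>M) = 0"
    and deg2: "\<And>y. y \<in> space M \<Longrightarrow> (\<integral>x. h x y \<partial>M) = 0"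
  shows "(\<integral>X. (\<Sum>i<n. \<Sum>j<i. h (X i) (X j))\<^sup>2 \<partial>PiM {..<n} (\<lambda>_. M)) =
    real n * (real n - 1) / 2 * (\<integral>x. (\<integral>y. (h x y)\<^sup>2 \<partial>M) \<partial>M)"
proof (induction n)
  case 0
  show ?case by simp
next
  case (Suc n)
  let ?N = "PiM {..<n} (\<lambda>_. M)"
  interpret N: prob_space ?N
    by (intro prob_space_PiM) unfold_locales
  interpret NM: pair_prob_space ?N M ..
  define V where "V = (\<lambda>(m::nat) X. \<Sum>i<m. \<Sum>j<i. h (X i) (X j))"
  define L where "L = (\<lambda>X y. \<Sum>j<n. h y (X j))"
  define H where "H = (\<integral>x. (\<integral>y. (h x y)\<^sup>2 \<partial>M) \<partial>M)"
  \<comment> \<open>Nonnegativity allows the bound on a row of \<open>i\<close> terms to be enlarged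
    to \<open>m\<close> terms.\<close>
  define C' where "C' = max C 0"
  have bnd': "\<And>x y. x \<in> space M \<Longrightarrow> y \<in> space M \<Longrightarrow> \<bar>h x y\<bar> \<le> C'" and C': "C' \<ge> 0"
    using bnd by (fastforce simp: C'_def)+
  have bV: "\<bar>V m X\<bar> \<le> real m * (real m * C')" if X: "X \<in> space (PiM {..<m} (\<lambda>_. M))" for X m
    unfolding V_def
  proof (intro abs_sum_le_real)
    fix i assume "i < m"
    then have "\<bar>\<Sum>j<i. h (X i) (X j)\<bar> \<le> real i * C'"
      by (intro abs_sum_le_real bnd' space_iidD[OF X]) auto
    also have "\<dots> \<le> real m * C'"
      using \<open>i < m\<close> C' by (intro mult_right_mono) auto
    finally show "\<bar>\<Sum>j<i. h (X i) (X j)\<bar> \<le> real m * C'" .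
  qed
  have bL: "\<bar>L X y\<bar> \<le> real n * C'" if "X \<in> space ?N" "y \<in> space M" for X y
    unfolding L_def using that by (intro abs_sum_le_real bnd') (auto intro: space_iidD)
  have [measurable]: "(\<lambda>X. h (X i) (X j)) \<in> borel_measurable (PiM {..<m} (\<lambda>_. M))" if "i < m" "j < m" for i j m
    using that by (intro measurable_compose[OF _ h, of "\<lambda>X. (X i, X j)", simplified]) measurable
  have [measurable]: "(\<lambda>X. V m X) \<in> borel_measurable (PiM {..<m} (\<lambda>_. M))" for m
    unfolding V_def by (intro borel_measurable_sum) auto
  have mL[measurable]: "(\<lambda>(X, y). L X y) \<in> borel_measurable (?N \<Otimes>\<^sub>M M)"
    unfolding L_def split_beta
    by (intro borel_measurable_sum measurable_compose[OF _ h, of "\<lambda>p. (snd p, fst p j)" for j, simplified])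
      measurable
  have mL1: "(\<lambda>y. L X y) \<in> borel_measurable M" if X: "X \<in> space ?N" for X
    using measurable_compose[OF measurable_Pair1'[OF X] mL] by simp
  have V_upd: "V (Suc n) (X(n := y)) = V n X + L X y" for X y
    by (simp add: V_def L_def)
  have "(\<integral>X. (V (Suc n) X)\<^sup>2 \<partial>PiM {..<Suc n} (\<lambda>_. M)) =
        (\<integral>X. (\<integral>y. (V (Suc n) (X(n := y)))\<^sup>2 \<partial>M) \<partial>?N)"
    by (intro expectation_iid_insert[where C = "(real (Suc n) * (real (Suc n) * C'))\<^sup>2"] abs_power2_le bV)
        (auto simp del: of_nat_Suc)
  also have "\<dots> = (\<integral>X. (V n X)\<^sup>2 + (\<integral>y. (L X y)\<^sup>2 \<partial>M) \<partial>?N)"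
  proof (intro Bochner_Integration.integral_cong refl)
    fix X assume X: "X \<in> space ?N"
    have iL: "integrable M (L X)"
      by (intro integrable_bounded[where C = "real n * C'"] mL1 X bL)
    have iL2: "integrable M (\<lambda>y. (L X y)\<^sup>2)"
      using mL1[OF X] by (intro integrable_bounded[where C = "(real n * C')\<^sup>2"] abs_power2_le bL)
        (auto intro: X)
    have ih: "integrable M (\<lambda>y. h y (X j))" if "j < n" for j
      using space_iidD[OF X that]
      using measurable_compose[OF measurable_Pair2' h, of "X j"]
      by (intro integrable_bounded[where C = C'] bnd') auto
    have "(\<integral>y. L X y \<partial>M) = 0"
      unfolding L_def using space_iidD[OF X] ih by (subst Bochner_Integration.integral_sum) (auto simp: deg2)
    moreover have "(\<integral>y. (V (Suc n) (X(n := y)))\<^sup>2 \<partial>M) =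
        (\<integral>y. (V n X)\<^sup>2 + 2 * V n X * L X y + (L X y)\<^sup>2 \<partial>M)"
      by (simp add: V_upd power2_sum algebra_simps)
    ultimately show "(\<integral>y. (V (Suc n) (X(n := y)))\<^sup>2 \<partial>M) = (V n X)\<^sup>2 + (\<integral>y. (L X y)\<^sup>2 \<partial>M)"
      using iL iL2 by (simp add: prob_space)
  qed
  also have "\<dots> = (\<integral>X. (V n X)\<^sup>2 \<partial>?N) + (\<integral>X. (\<integral>y. (L X y)\<^sup>2 \<partial>M) \<partial>?N)"
  proof (rule Bochner_Integration.integral_add)
    show "integrable ?N (\<lambda>X. (V n X)\<^sup>2)"
      by (intro N.integrable_bounded[where C = "(real n * (real n * C'))\<^sup>2"] abs_power2_le bV) auto
    show "integrable ?N (\<lambda>X. (\<integral>y. (L X y)\<^sup>2 \<partial>M))"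
    proof (intro N.integrable_bounded[where C = "(real n * C')\<^sup>2"])
      show "(\<lambda>X. (\<integral>y. (L X y)\<^sup>2 \<partial>M)) \<in> borel_measurable ?N" by measurable
      fix X assume "X \<in> space ?N"
      then show "\<bar>\<integral>y. (L X y)\<^sup>2 \<partial>M\<bar> \<le> (real n * C')\<^sup>2"
        using mL1 by (intro abs_expectation_le abs_power2_le bL) auto
    qed
  qed
  \<comment> \<open>With the order exchanged, \<open>y\<close> is fixed and the
    \<open>h y (X j)\<close> are i.i.d.; they are centred by \<open>deg1\<close>, so the formula for
    linear sums applies.\<close>
  also have "(\<integral>X. (\<integral>y. (L X y)\<^sup>2 \<partial>M) \<partial>?N) = (\<integral>y. (\<integral>X. (L X y)\<^sup>2 \<partial>?N) \<partial>M)"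
  proof (rule NM.Fubini_integral[symmetric])
    show "integrable (?N \<Otimes>\<^sub>M M) (\<lambda>(X, y). (L X y)\<^sup>2)"
      by (intro NM.P.integrable_bounded[where C = "(real n * C')\<^sup>2"])
        (auto intro!: power2_le_of_abs_le bL simp: space_pair_measure)
  qed
  also have "\<dots> = (\<integral>y. real n * (\<integral>x. (h y x)\<^sup>2 \<partial>M) \<partial>M)"
  proof (intro Bochner_Integration.integral_cong refl)
    fix y assume y: "y \<in> space M"
    have "h y \<in> borel_measurable M"
      using measurable_compose[OF measurable_Pair1'[OF y] h] by simp
    then show "(\<integral>X. (L X y)\<^sup>2 \<partial>?N) = real n * (\<integral>x. (h y x)\<^sup>2 \<partial>M)"
      unfolding L_def by (rule expectation_sum_centered_power2[OF _ bnd'[OF y] deg1[OF y]])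
  qed
  also have "\<dots> = real n * H"
    by (simp add: H_def)
  finally have step: "(\<integral>X. (V (Suc n) X)\<^sup>2 \<partial>PiM {..<Suc n} (\<lambda>_. M)) = (\<integral>X. (V n X)\<^sup>2 \<partial>?N) + real n * H" .
  have IH: "(\<integral>X. (V n X)\<^sup>2 \<partial>?N) = real n * (real n - 1) / 2 * H"
    unfolding V_def H_def by (rule Suc.IH)
  have "real n * (real n - 1) / 2 * H + real n * H = real (Suc n) * (real (Suc n) - 1) / 2 * H"
    by (simp add: field_simps)
  then show ?case
    using step unfolding IH unfolding V_def H_def by (simp only:)
qed

text \<open>The Hoeffding decomposition splits the statistic into the degenerate kernel
  \<open>h x y - g x - g y + \<mu>\<close> and the linear part \<open>\<Sum>i. g (X i) - \<mu>\<close>.\<close>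

lemma expectation_U_statistic_power2_le:
  fixes h :: "'a \<Rightarrow> 'a \<Rightarrow> real"
  assumes h[measurable]: "case_prod h \<in> borel_measurable (M \<Otimes>\<^sub>M M)"
    and bnd: "\<And>x y. x \<in> space M \<Longrightarrow> y \<in> space M \<Longrightarrow> \<bar>h x y\<bar> \<le> C"
    and sym: "\<And>x y. h x y = h y x"
  defines "g \<equiv> \<lambda>x. \<integral>y. h x y \<partial>M"
  defines "\<mu> \<equiv> expectation g"
  shows "(\<integral>X. ((\<Sum>i<n. \<Sum>j<i. h (X i) (X j)) - real n * (real n - 1) / 2 * \<mu>)\<^sup>2 \<partial>PiM {..<n} (\<lambda>_. M))
    \<le> real n ^ 2 * (\<integral>x. (\<integral>y. (h x y)\<^sup>2 \<partial>M) \<partial>M) + 2 * real n ^ 3 * expectation (\<lambda>x. (g x)\<^sup>2)"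
    (is "?lhs \<le> _ * ?H + _ * ?G")
proof (cases "n = 0")
  case False
  let ?N = "PiM {..<n} (\<lambda>_. M)"
  interpret N: prob_space ?N
    by (intro prob_space_PiM) unfold_locales
  have mh1: "(\<lambda>y. h x y) \<in> borel_measurable M" if "x \<in> space M" for x
    using measurable_compose[OF measurable_Pair1'[OF that] h] by simp
  have [measurable]: "g \<in> borel_measurable M"
    unfolding g_def by measurable
  have bg: "\<bar>g x\<bar> \<le> C" if "x \<in> space M" for x
    unfolding g_def using that by (intro abs_expectation_le mh1 bnd)
  have b\<mu>: "\<bar>\<mu>\<bar> \<le> C"
    unfolding \<mu>_def by (intro abs_expectation_le bg) auto
  have ig: "integrable M g" by (rule integrable_bounded[where C = C]) (auto intro: bg)
  have ih: "integrable M (h x)" if "x \<in> space M" for x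
    using that by (intro integrable_bounded[where C = C] mh1 bnd)
  \<comment> \<open>Degeneracy is reached in two centrings: \<open>k\<close> has mean zero in
    \<open>y\<close>, and \<open>d\<close> subtracts from \<open>k\<close> its mean in
    \<open>x\<close>, which is \<open>g y - \<mu>\<close>. Each centring can only lower the second
    moment, whence the bound by that of \<open>h\<close> without further constants.\<close>
  define k where "k = (\<lambda>x y. h x y - g x)"
  define d where "d = (\<lambda>x y. k x y - (g y - \<mu>))"
  have mk[measurable]: "case_prod k \<in> borel_measurable (M \<Otimes>\<^sub>M M)"
    unfolding k_def split_beta
    by (intro borel_measurable_diff h[unfolded split_beta]) measurable
  have md[measurable]: "case_prod d \<in> borel_measurable (M \<Otimes>\<^sub>M M)"
    unfolding d_def split_beta
    by (intro borel_measurable_diff mk[unfolded split_beta]) measurable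
  have bk: "\<bar>k x y\<bar> \<le> 2 * C" if "x \<in> space M" "y \<in> space M" for x y
    using bnd[OF that] bg[OF that(1)] unfolding k_def by linarith
  have bd: "\<bar>d x y\<bar> \<le> 4 * C" if "x \<in> space M" "y \<in> space M" for x y
    using bk[OF that] bg[OF that(2)] b\<mu> unfolding d_def by linarith
  have mk1: "(\<lambda>y. k x y) \<in> borel_measurable M" if "x \<in> space M" for x
    using measurable_compose[OF measurable_Pair1'[OF that] mk] by simp
  have mk2: "(\<lambda>x. k x y) \<in> borel_measurable M" if "y \<in> space M" for y
    using measurable_compose[OF measurable_Pair2'[OF that] mk] by simp
  have Ek: "(\<integral>x. k x y \<partial>M) = g y - \<mu>" if "y \<in> space M" for y
    using ih[OF that] ig unfolding k_def \<mu>_def by (subst sym) (simp add: g_def)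
  have d_sym: "d x y = d y x" for x y
    unfolding d_def k_def by (simp add: sym)
  have Ed2: "(\<integral>x. d x y \<partial>M) = 0" if "y \<in> space M" for y
    unfolding d_def using that
    by (subst Bochner_Integration.integral_diff)
        (auto simp: Ek prob_space intro!: integrable_bounded[OF mk2 bk])
  have Ed1: "(\<integral>y. d x y \<partial>M) = 0" if "x \<in> space M" for x
    using Ed2[OF that] by (subst d_sym)
  \<comment> \<open>The second centring acts on \<open>x\<close> for fixed \<open>y\<close>, so the
    inner integral has to run over \<open>x\<close> before it is applied.\<close>
  have "(\<integral>x. (\<integral>y. (d x y)\<^sup>2 \<partial>M) \<partial>M) = (\<integral>y. (\<integral>x. (d x y)\<^sup>2 \<partial>M) \<partial>M)"
    by (intro expectation_swap[symmetric, where C = "(4 * C)\<^sup>2"] abs_power2_le bd) auto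
  also have "\<dots> \<le> (\<integral>y. (\<integral>x. (k x y)\<^sup>2 \<partial>M) \<partial>M)"
  proof (rule integral_mono)
    show "integrable M (\<lambda>y. \<integral>x. (d x y)\<^sup>2 \<partial>M)"
    proof (intro integrable_bounded[where C = "(4 * C)\<^sup>2"])
      fix y assume "y \<in> space M"
      then show "\<bar>\<integral>x. (d x y)\<^sup>2 \<partial>M\<bar> \<le> (4 * C)\<^sup>2"
        using measurable_compose[OF measurable_Pair2' md]
        by (intro abs_expectation_le abs_power2_le bd) auto
    qed measurable
    show "integrable M (\<lambda>y. \<integral>x. (k x y)\<^sup>2 \<partial>M)"
    proof (intro integrable_bounded[where C = "(2 * C)\<^sup>2"])
      fix y assume "y \<in> space M"
      then show "\<bar>\<integral>x. (k x y)\<^sup>2 \<partial>M\<bar> \<le> (2 * C)\<^sup>2"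
        using mk2 by (intro abs_expectation_le abs_power2_le bk) auto
    qed measurable
    fix y assume y: "y \<in> space M"
    show "(\<integral>x. (d x y)\<^sup>2 \<partial>M) \<le> (\<integral>x. (k x y)\<^sup>2 \<partial>M)"
      using expectation_centered_power2_le[OF mk2[OF y] bk[OF _ y]] by (simp add: Ek y d_def)
  qed
  also have "\<dots> = (\<integral>x. (\<integral>y. (k x y)\<^sup>2 \<partial>M) \<partial>M)"
    by (intro expectation_swap[where C = "(2 * C)\<^sup>2"] abs_power2_le bk) auto
  also have "\<dots> \<le> ?H"
  proof (rule integral_mono)
    show "integrable M (\<lambda>x. \<integral>y. (k x y)\<^sup>2 \<partial>M)"
    proof (intro integrable_bounded[where C = "(2 * C)\<^sup>2"])
      fix x assume "x \<in> space M"
      then show "\<bar>\<integral>y. (k x y)\<^sup>2 \<partial>M\<bar> \<le> (2 * C)\<^sup>2"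
        using mk1 by (intro abs_expectation_le abs_power2_le bk) auto
    qed measurable
    show "integrable M (\<lambda>x. \<integral>y. (h x y)\<^sup>2 \<partial>M)"
    proof (intro integrable_bounded[where C = "C\<^sup>2"])
      fix x assume "x \<in> space M"
      then show "\<bar>\<integral>y. (h x y)\<^sup>2 \<partial>M\<bar> \<le> C\<^sup>2"
        using mh1 by (intro abs_expectation_le abs_power2_le bnd) auto
    qed measurable
    fix x assume x: "x \<in> space M"
    show "(\<integral>y. (k x y)\<^sup>2 \<partial>M) \<le> (\<integral>y. (h x y)\<^sup>2 \<partial>M)"
      using expectation_centered_power2_le[OF mh1[OF x] bnd[OF x]] by (simp add: k_def g_def)
  qed
  finally have dH: "(\<integral>x. (\<integral>y. (d x y)\<^sup>2 \<partial>M) \<partial>M) \<le> ?H" .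
  have H0: "0 \<le> ?H" by simp
  define V where "V = (\<lambda>X. \<Sum>i<n. \<Sum>j<i. d (X i) (X j))"
  define L where "L = (\<lambda>X. \<Sum>i<n. g (X i) - \<mu>)"
  have sum_lt: "(\<Sum>i<n. \<Sum>j<i. a i + a j) = (real n - 1) * (\<Sum>i<n. a i)" for a :: "nat \<Rightarrow> real" and n
    by (induction n) (auto simp: sum.distrib algebra_simps)
  have decomp: "(\<Sum>i<n. \<Sum>j<i. h (X i) (X j)) - real n * (real n - 1) / 2 * \<mu> = V X + (real n - 1) * L X" for X
  proof -
    have *: "(\<Sum>i<n. \<Sum>j<i. \<mu>) = real n * (real n - 1) / 2 * \<mu>" for n
      by (induction n) (auto simp: field_simps)
    have "(\<Sum>i<n. \<Sum>j<i. h (X i) (X j)) =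
        (\<Sum>i<n. \<Sum>j<i. d (X i) (X j) + ((g (X i) - \<mu>) + (g (X j) - \<mu>)) + \<mu>)"
      by (simp add: d_def k_def)
    also have "\<dots> = V X + (\<Sum>i<n. \<Sum>j<i. (g (X i) - \<mu>) + (g (X j) - \<mu>)) + (\<Sum>i<n. \<Sum>j<i. \<mu>)"
      unfolding V_def by (simp only: sum.distrib)
    finally show ?thesis unfolding sum_lt L_def * by simp
  qed
  have V2: "(\<integral>X. (V X)\<^sup>2 \<partial>?N) = real n * (real n - 1) / 2 * (\<integral>x. (\<integral>y. (d x y)\<^sup>2 \<partial>M) \<partial>M)"
    unfolding V_def
    by (intro expectation_degenerate_U_statistic_power2[where C = "4 * C"] md bd Ed1 Ed2)
  have bgm: "\<bar>g x - \<mu>\<bar> \<le> 2 * C" if "x \<in> space M" for x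
    using bg[OF that] b\<mu> by linarith
  have "(\<integral>X. (L X)\<^sup>2 \<partial>?N) = real n * expectation (\<lambda>x. (g x - \<mu>)\<^sup>2)"
    unfolding L_def
    by (intro expectation_sum_centered_power2[where C = "2 * C"] bgm)
        (auto simp: ig prob_space \<mu>_def)
  also have "\<dots> \<le> real n * ?G"
    unfolding \<mu>_def by (intro mult_left_mono expectation_centered_power2_le[where C = C] bg) auto
  finally have L2: "(\<integral>X. (L X)\<^sup>2 \<partial>?N) \<le> real n * ?G" .
  have C0: "C \<ge> 0" using b\<mu> by linarith
  have bV: "\<bar>V X\<bar> \<le> real n * (real n * (4 * C))" if X: "X \<in> space ?N" for X
    unfolding V_def
  proof (intro abs_sum_le_real)
    fix i assume "i < n"
    then have "\<bar>\<Sum>j<i. d (X i) (X j)\<bar> \<le> real i * (4 * C)"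
      by (intro abs_sum_le_real bd space_iidD[OF X]) auto
    also have "\<dots> \<le> real n * (4 * C)"
      using \<open>i < n\<close> C0 by (intro mult_right_mono) auto
    finally show "\<bar>\<Sum>j<i. d (X i) (X j)\<bar> \<le> real n * (4 * C)" .
  qed
  have bL: "\<bar>L X\<bar> \<le> real n * (2 * C)" if "X \<in> space ?N" for X
    unfolding L_def using that by (intro abs_sum_le_real bgm space_iidD)
  have md': "(\<lambda>X. d (X i) (X j)) \<in> borel_measurable ?N" if "i < n" "j < n" for i j
    using that by (intro measurable_compose[OF _ md, of "\<lambda>X. (X i, X j)", simplified]) measurable
  have [measurable]: "V \<in> borel_measurable ?N"
    unfolding V_def by (intro borel_measurable_sum md') auto
  have [measurable]: "L \<in> borel_measurable ?N"
    unfolding L_def by measurable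
  have iV: "integrable ?N (\<lambda>X. (V X)\<^sup>2)"
    by (intro N.integrable_bounded[where C = "(real n * (real n * (4 * C)))\<^sup>2"] abs_power2_le bV) auto
  have iL: "integrable ?N (\<lambda>X. (L X)\<^sup>2)"
    by (intro N.integrable_bounded[where C = "(real n * (2 * C))\<^sup>2"] abs_power2_le bL) auto
  \<comment> \<open>The two parts are in fact orthogonal; the crude inequality costs a factor 2 and
    avoids computing the mixed moment.\<close>
  have ineq: "(V X + (real n - 1) * L X)\<^sup>2 \<le> 2 * (V X)\<^sup>2 + 2 * (real n - 1)\<^sup>2 * (L X)\<^sup>2" for X
    using sum_squares_bound[of "V X" "(real n - 1) * L X"]
    unfolding power2_sum power_mult_distrib by linarith
  have "?lhs = (\<integral>X. (V X + (real n - 1) * L X)\<^sup>2 \<partial>?N)"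
    unfolding decomp ..
  also have "\<dots> \<le> (\<integral>X. 2 * (V X)\<^sup>2 + 2 * (real n - 1)\<^sup>2 * (L X)\<^sup>2 \<partial>?N)"
  proof (rule integral_mono'[OF _ ineq])
    show "integrable ?N (\<lambda>X. 2 * (V X)\<^sup>2 + 2 * (real n - 1)\<^sup>2 * (L X)\<^sup>2)"
      using iV iL by auto
  qed auto
  also have "\<dots> = 2 * (\<integral>X. (V X)\<^sup>2 \<partial>?N) + 2 * (real n - 1)\<^sup>2 * (\<integral>X. (L X)\<^sup>2 \<partial>?N)"
    using iV iL by simp
  also have "\<dots> \<le> real n ^ 2 * ?H + 2 * real n ^ 2 * (real n * ?G)"
  proof (intro add_mono)
    have n1: "real n \<ge> 1" using False by simp
    have "2 * (\<integral>X. (V X)\<^sup>2 \<partial>?N) = real n * (real n - 1) * (\<integral>x. (\<integral>y. (d x y)\<^sup>2 \<partial>M) \<partial>M)"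
      unfolding V2 by simp
    also have "\<dots> \<le> real n * (real n - 1) * ?H"
      using n1 dH by (intro mult_left_mono) auto
    also have "\<dots> \<le> real n ^ 2 * ?H"
      using n1 H0 by (intro mult_right_mono) (auto simp: power2_eq_square)
    finally show "2 * (\<integral>X. (V X)\<^sup>2 \<partial>?N) \<le> real n ^ 2 * ?H" .
    have "(real n - 1)\<^sup>2 \<le> real n ^ 2"
      using n1 by (intro power_mono) auto
    moreover have "0 \<le> (\<integral>X. (L X)\<^sup>2 \<partial>?N)" by simp
    ultimately show "2 * (real n - 1)\<^sup>2 * (\<integral>X. (L X)\<^sup>2 \<partial>?N) \<le> 2 * real n ^ 2 * (real n * ?G)"
      using L2 by (intro mult_mono) auto
  qed
  finally show ?thesis by (simp add: power3_eq_cube power2_eq_square mult.assoc)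
qed (simp add: power2_eq_square)

end

subsection \<open>Bounded orthonormal systems and the kernel under an alternative\<close>

text \<open>Absolute summability of \<open>a\<close> together with one integrable majorant of all
  \<open>f k\<close> justifies the exchange. The majorant need not be bounded:
  \<open>parseval_RKHS\<close> uses \<open>\<bar>h x\<bar> * B\<close> with \<open>h\<close> merely
  square integrable.\<close>

lemma integral_weighted_series:
  fixes f :: "nat \<Rightarrow> 'a \<Rightarrow> real" and a :: "nat \<Rightarrow> real"
  assumes F: "integrable M F"
    and f[measurable]: "\<And>k. f k \<in> borel_measurable M"
    and bnd: "\<And>k x. x \<in> space M \<Longrightarrow> \<bar>f k x\<bar> \<le> F x"
    and a: "summable (\<lambda>k. \<bar>a k\<bar>)"
  shows "(\<integral>x. (\<Sum>k. a k * f k x) \<partial>M) = (\<Sum>k. a k * (\<integral>x. f k x \<partial>M))"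
proof -
  have int: "integrable M (f k)" for k
    using F by (rule Bochner_Integration.integrable_bound) (auto intro!: AE_I2 bnd order_trans[OF bnd])
  have int': "integrable M (\<lambda>x. a k * f k x)" for k
    using int by simp
  have 1: "AE x in M. summable (\<lambda>k. norm (a k * f k x))"
  proof (rule AE_I2)
    fix x assume x: "x \<in> space M"
    show "summable (\<lambda>k. norm (a k * f k x))"
      by (rule summable_comparison_test'[OF summable_mult2[OF a, of "F x"]])
        (auto simp: abs_mult intro!: mult_left_mono bnd x)
  qed
  have 2: "summable (\<lambda>k. \<integral>x. norm (a k * f k x) \<partial>M)"
  proof (rule summable_comparison_test'[OF summable_mult2[OF a, of "integral\<^sup>L M F"]])
    fix k
    have "(\<integral>x. \<bar>f k x\<bar> \<partial>M) \<le> integral\<^sup>L M F"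
      using int F bnd by (intro integral_mono) auto
    then show "norm (\<integral>x. norm (a k * f k x) \<partial>M) \<le> \<bar>a k\<bar> * integral\<^sup>L M F"
      by (simp add: abs_mult mult_left_mono)
  qed
  show "(\<integral>x. (\<Sum>k. a k * f k x) \<partial>M) = (\<Sum>k. a k * (\<integral>x. f k x \<partial>M))"
    using integral_suminf[OF int' 1 2] by simp
qed

lemma abs_weighted_series_le:
  fixes a f :: "nat \<Rightarrow> real"
  assumes a: "summable (\<lambda>k. \<bar>a k\<bar>)" and f: "\<And>k. \<bar>f k\<bar> \<le> C"
  shows "\<bar>\<Sum>k. a k * f k\<bar> \<le> (\<Sum>k. \<bar>a k\<bar>) * C"
    and "summable (\<lambda>k. \<bar>a k * f k\<bar>)"
proof -
  have le: "\<bar>a k * f k\<bar> \<le> \<bar>a k\<bar> * C" for k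
    unfolding abs_mult using f by (intro mult_left_mono) auto
  show s: "summable (\<lambda>k. \<bar>a k * f k\<bar>)"
    by (rule summable_comparison_test'[OF summable_mult2[OF a, of C]]) (simp add: le)
  have "\<bar>\<Sum>k. a k * f k\<bar> \<le> (\<Sum>k. \<bar>a k * f k\<bar>)"
    by (rule summable_rabs[OF s])
  also have "\<dots> \<le> (\<Sum>k. \<bar>a k\<bar> * C)"
    by (intro suminf_le le s summable_mult2 a)
  finally show "\<bar>\<Sum>k. a k * f k\<bar> \<le> (\<Sum>k. \<bar>a k\<bar>) * C"
    using suminf_mult2[OF a, of C] by simp
qed

text \<open>Expand the square of \<open>q * \<bar>x\<bar> - p * \<bar>y\<bar>\<close>. With
  \<open>p\<close> and \<open>q\<close> set to the two norms, summing or integrating this pointwise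
  bound yields the Cauchy-Schwarz inequality.\<close>

lemma two_mult_abs_le:
  fixes x y p q :: real
  assumes "p > 0" "q > 0"
  shows "2 * \<bar>x * y\<bar> \<le> (q / p) * x\<^sup>2 + (p / q) * y\<^sup>2"
proof -
  have "0 \<le> (q * \<bar>x\<bar> - p * \<bar>y\<bar>)\<^sup>2 / (p * q)"
    using assms by simp
  also have "\<dots> = (q / p) * x\<^sup>2 + (p / q) * y\<^sup>2 - 2 * \<bar>x * y\<bar>"
    using assms by (simp add: field_simps power2_eq_square abs_mult)
  finally show ?thesis by simp
qed

section \<open>Square-integrable functions\<close>

lemma integrable_L2_mult:
  assumes "f \<in> L2 M" "g \<in> L2 M"
  shows "integrable M (\<lambda>x. f x * g x)"
proof (rule Bochner_Integration.integrable_bound)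
  show "integrable M (\<lambda>x. (f x)\<^sup>2 + (g x)\<^sup>2)"
    using assms by (simp add: L2_def)
  show "(\<lambda>x. f x * g x) \<in> borel_measurable M"
    using assms by (auto simp: L2_def)
  have "\<bar>a * b\<bar> \<le> a\<^sup>2 + b\<^sup>2" for a b :: real
    using sum_squares_bound[of "\<bar>a\<bar>" "\<bar>b\<bar>"] abs_ge_zero[of "a * b"] unfolding abs_mult power2_abs by linarith
  then show "AE x in M. norm (f x * g x) \<le> norm ((f x)\<^sup>2 + (g x)\<^sup>2)"
    by (intro AE_I2) simp
qed

lemma L2_diff:
  assumes "f \<in> L2 M" "g \<in> L2 M"
  shows "(\<lambda>x. f x - g x) \<in> L2 M"
proof -
  have "integrable M (\<lambda>x. (f x)\<^sup>2 + (g x)\<^sup>2 - 2 * (f x * g x))"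
    using assms integrable_L2_mult[OF assms] by (simp add: L2_def)
  then show ?thesis
    using assms by (auto simp: L2_def power2_diff mult.assoc)
qed

lemma L2_sum:
  assumes "finite I" "\<And>i. i \<in> I \<Longrightarrow> f i \<in> L2 M"
  shows "(\<lambda>x. \<Sum>i\<in>I. a i * f i x) \<in> L2 M"
  using assms
proof (induction I)
  case empty
  then show ?case by (simp add: L2_def)
next
  case (insert j I)
  have 1: "(\<lambda>x. - a j * f j x) \<in> L2 M"
    using insert.prems[of j] by (auto simp: L2_def power_mult_distrib)
  have "(\<lambda>x. \<Sum>i\<in>I. a i * f i x) \<in> L2 M"
    using insert by auto
  from L2_diff[OF this 1] show ?case
    using insert.hyps by (simp add: add.commute)
qed

text \<open>Cauchy-Schwarz with positive upper bounds \<open>p\<close> and \<open>q\<close> in place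
  of the norms, so that a vanishing norm needs no separate treatment.\<close>

lemma integral_abs_mult_le:
  assumes f: "f \<in> L2 M" and g: "g \<in> L2 M"
    and p: "(\<integral>x. (f x)\<^sup>2 \<partial>M) \<le> p\<^sup>2" "p > 0" and q: "(\<integral>x. (g x)\<^sup>2 \<partial>M) \<le> q\<^sup>2" "q > 0"
  shows "(\<integral>x. \<bar>f x * g x\<bar> \<partial>M) \<le> p * q"
proof -
  have "(\<integral>x. 2 * \<bar>f x * g x\<bar> \<partial>M) \<le> (\<integral>x. (q / p) * (f x)\<^sup>2 + (p / q) * (g x)\<^sup>2 \<partial>M)"
    using f g integrable_L2_mult[OF f g] two_mult_abs_le[OF p(2) q(2)]
    by (intro integral_mono) (auto simp: L2_def)
  also have "\<dots> = (q / p) * (\<integral>x. (f x)\<^sup>2 \<partial>M) + (p / q) * (\<integral>x. (g x)\<^sup>2 \<partial>M)"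
    using f g by (simp add: L2_def)
  also have "\<dots> \<le> (q / p) * p\<^sup>2 + (p / q) * q\<^sup>2"
    using p q by (intro add_mono mult_left_mono) auto
  also have "\<dots> = 2 * (p * q)"
    using p q by (simp add: field_simps power2_eq_square)
  finally show ?thesis by simp
qed

section \<open>Fourier coefficients in a bounded orthonormal system\<close>

locale bounded_orthonormal = prob_space P0 for P0 :: "'a measure" +
  fixes phi :: "nat \<Rightarrow> 'a \<Rightarrow> real" and B :: real
  assumes phi_measurable[measurable]: "\<And>k. phi k \<in> borel_measurable P0"
    and phi_bound: "\<And>k x. x \<in> space P0 \<Longrightarrow> \<bar>phi k x\<bar> \<le> B"
    and phi_mean: "\<And>k. (\<integral>x. phi k x \<partial>P0) = 0"
    and phi_orth: "\<And>j k. (\<integral>x. phi j x * phi k x \<partial>P0) = (if j = k then 1 else 0)"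
begin

lemma B_nonneg: "B \<ge> 0"
proof -
  obtain x where "x \<in> space P0" using not_empty by blast
  from phi_bound[OF this, of 0] show ?thesis by linarith
qed

lemma phi_L2: "phi k \<in> L2 P0"
  unfolding L2_def using integrable_bounded[of "\<lambda>x. (phi k x)\<^sup>2" "B\<^sup>2"] abs_power2_le[OF phi_bound] by simp

text \<open>The residual of a partial Fourier sum \<open>S\<close> has nonnegative squared norm, and
  both the inner product of \<open>f\<close> with \<open>S\<close> and the squared norm of
  \<open>S\<close> equal the sum of the squared coefficients.\<close>

lemma bessel:
  assumes f: "f \<in> L2 P0"
  shows "summable (\<lambda>k. (L2_inner P0 f (phi k))\<^sup>2)"
    and "(\<Sum>k. (L2_inner P0 f (phi k))\<^sup>2) \<le> (\<integral>x. (f x)\<^sup>2 \<partial>P0)"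
proof -
  let ?c = "\<lambda>k. L2_inner P0 f (phi k)"
  have le: "(\<Sum>k<n. (?c k)\<^sup>2) \<le> (\<integral>x. (f x)\<^sup>2 \<partial>P0)" for n
  proof -
    define S where "S = (\<lambda>x. \<Sum>k<n. ?c k * phi k x)"
    have S: "S \<in> L2 P0" unfolding S_def by (intro L2_sum phi_L2) auto
    have inner: "(\<integral>x. g x * S x \<partial>P0) = (\<Sum>k<n. ?c k * (\<integral>x. g x * phi k x \<partial>P0))" if g: "g \<in> L2 P0" for g
    proof -
      have "(\<integral>x. g x * S x \<partial>P0) = (\<integral>x. (\<Sum>k<n. ?c k * (g x * phi k x)) \<partial>P0)"
        unfolding S_def by (simp add: sum_distrib_left algebra_simps)
      also have "\<dots> = (\<Sum>k<n. \<integral>x. ?c k * (g x * phi k x) \<partial>P0)"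
        using integrable_L2_mult[OF g phi_L2] by (intro Bochner_Integration.integral_sum) simp
      finally show ?thesis by simp
    qed
    have SS: "(\<integral>x. phi k x * S x \<partial>P0) = ?c k" if "k < n" for k
      using that unfolding inner[OF phi_L2] phi_orth by (simp add: if_distrib sum.delta' cong: if_cong)
    have "0 \<le> (\<integral>x. (f x - S x)\<^sup>2 \<partial>P0)" by simp
    also have "\<dots> = (\<integral>x. (f x)\<^sup>2 + S x * S x - 2 * (f x * S x) \<partial>P0)"
      by (simp add: power2_eq_square algebra_simps)
    also have "\<dots> = (\<integral>x. (f x)\<^sup>2 \<partial>P0) + (\<integral>x. S x * S x \<partial>P0) - 2 * (\<integral>x. f x * S x \<partial>P0)"
      using f S integrable_L2_mult[OF f S] integrable_L2_mult[OF S S] by (simp add: L2_def)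
    also have "(\<integral>x. f x * S x \<partial>P0) = (\<Sum>k<n. (?c k)\<^sup>2)"
      unfolding inner[OF f] by (simp add: L2_inner_def power2_eq_square)
    also have "(\<integral>x. S x * S x \<partial>P0) = (\<Sum>k<n. (?c k)\<^sup>2)"
      unfolding inner[OF S] by (intro sum.cong refl) (simp add: SS mult.commute[of "S _"] power2_eq_square)
    finally show ?thesis by simp
  qed
  show "summable (\<lambda>k. (?c k)\<^sup>2)"
    by (intro summableI_nonneg_bounded[where x = "\<integral>x. (f x)\<^sup>2 \<partial>P0"] le) simp
  then show "(\<Sum>k. (?c k)\<^sup>2) \<le> (\<integral>x. (f x)\<^sup>2 \<partial>P0)"
    by (intro suminf_le_const le) auto
qed

end

text \<open>\<open>P\<close> stands for the alternative with density \<open>1 + u\<close>; the density enters only through the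
  integrals of bounded functions.\<close>

locale density_alternative = bounded_orthonormal P0 phi B + P: prob_space P
  for P0 :: "'a measure" and phi B and P :: "'a measure" +
  fixes u :: "'a \<Rightarrow> real" and w :: "nat \<Rightarrow> real"
  assumes sets_P[measurable_cong]: "sets P = sets P0"
    and u_L2: "u \<in> L2 P0"
    and integral_P: "\<And>f C. f \<in> borel_measurable P0 \<Longrightarrow> (\<And>x. x \<in> space P0 \<Longrightarrow> \<bar>f x\<bar> \<le> C) \<Longrightarrow>
      (\<integral>x. f x \<partial>P) = (\<integral>x. f x \<partial>P0) + (\<integral>x. f x * u x \<partial>P0)"
    and w_pos: "\<And>k. 0 < w k" and w_le: "\<And>k. w k \<le> 1" and w_summable: "summable w"
begin

lemma space_P: "space P = space P0"
  using sets_P by (rule sets_eq_imp_space_eq)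

definition coef :: "nat \<Rightarrow> real" where
  "coef k = L2_inner P0 u (phi k)"

text \<open>This is \<open>Ktilde\<close> when
  \<open>w k = lam k / (lam k + \<rho>\<^sup>2)\<close>. The bracketing isolates a factor bounded by
  \<open>B\<^sup>2\<close>, as the lemmas on weighted series expect.\<close>

definition kern :: "'a \<Rightarrow> 'a \<Rightarrow> real" where
  "kern x y = (\<Sum>k. w k * (phi k x * phi k y))"

text \<open>The \<open>\<mu>\<close> of the overview: the mean of \<open>kern\<close> when both
  arguments are drawn independently from \<open>P\<close>.\<close>

definition signal :: real where
  "signal = (\<Sum>k. w k * (coef k)\<^sup>2)"

text \<open>The first-order Hoeffding projection of \<open>kern\<close> under \<open>P\<close>, as
  \<open>expectation_kern\<close> shows.\<close>

definition proj :: "'a \<Rightarrow> real" where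
  "proj x = (\<Sum>k. w k * coef k * phi k x)"

abbreviation "S \<equiv> suminf w"
abbreviation "N2 \<equiv> \<integral>x. (u x)\<^sup>2 \<partial>P0"

lemma w_abs: "summable (\<lambda>k. \<bar>w k\<bar>)" "\<bar>w k\<bar> = w k"
  using w_summable w_pos by (simp_all add: abs_of_pos)

lemma S_pos: "S > 0"
  by (intro suminf_pos w_summable w_pos)

text \<open>Since \<open>phi k\<close> has mean zero under \<open>P0\<close>, only the part of the
  density coming from \<open>u\<close> contributes. Being means of bounded functions, the
  coefficients inherit the bound \<open>B\<close>.\<close>

lemma coef_eq: "coef k = (\<integral>x. phi k x \<partial>P)"
  using integral_P[OF phi_measurable phi_bound, of k]
  by (simp add: phi_mean coef_def L2_inner_def mult.commute)

lemma coef_bound: "\<bar>coef k\<bar> \<le> B"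
  unfolding coef_eq using phi_bound by (intro P.abs_expectation_le) (auto simp: space_P)

lemma phi_mult_bound: "x \<in> space P0 \<Longrightarrow> y \<in> space P0 \<Longrightarrow> \<bar>phi k x * phi l y\<bar> \<le> B\<^sup>2"
  unfolding abs_mult power2_eq_square using B_nonneg by (intro mult_mono phi_bound) auto

lemma kern_bound: "x \<in> space P0 \<Longrightarrow> y \<in> space P0 \<Longrightarrow> \<bar>kern x y\<bar> \<le> S * B\<^sup>2"
  unfolding kern_def using abs_weighted_series_le(1)[OF w_abs(1) phi_mult_bound] by (simp add: w_abs(2))

lemma kern_measurable[measurable]: "case_prod kern \<in> borel_measurable (P0 \<Otimes>\<^sub>M P0)"
  unfolding kern_def split_beta by measurable

lemma kern_measurable1[measurable]: "kern x \<in> borel_measurable P0"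
  unfolding kern_def by measurable

lemma kern_sums:
  assumes "x \<in> space P0" "y \<in> space P0"
  shows "(\<lambda>k. w k * (phi k x * phi k y)) sums kern x y"
  unfolding kern_def
  by (intro summable_sums summable_rabs_cancel[OF abs_weighted_series_le(2)[OF w_abs(1) phi_mult_bound[OF assms]]])

lemma wcoef_summable: "summable (\<lambda>k. \<bar>w k * coef k\<bar>)"
  by (rule abs_weighted_series_le(2)[OF w_abs(1) coef_bound])

lemma expectation_kern:
  assumes x: "x \<in> space P0"
  shows "(\<integral>y. kern x y \<partial>P) = proj x"
proof -
  have "(\<integral>y. kern x y \<partial>P) = (\<Sum>k. w k * (\<integral>y. phi k x * phi k y \<partial>P))"
    unfolding kern_def
    by (rule integral_weighted_series[where F = "\<lambda>_. B\<^sup>2"])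
        (auto simp: space_P phi_mult_bound x w_abs(1))
  then show ?thesis by (simp add: coef_eq[symmetric] proj_def mult_ac)
qed

lemma proj_measurable[measurable]: "proj \<in> borel_measurable P0"
  unfolding proj_def by measurable

lemma expectation_proj: "(\<integral>x. proj x \<partial>P) = signal"
proof -
  have "(\<integral>x. proj x \<partial>P) = (\<Sum>k. w k * coef k * (\<integral>x. phi k x \<partial>P))"
    unfolding proj_def
    by (rule integral_weighted_series[where F = "\<lambda>_. B"])
        (auto simp: space_P phi_bound wcoef_summable)
  then show ?thesis by (simp add: coef_eq[symmetric] signal_def power2_eq_square mult.assoc)
qed

lemma coef2_summable: "summable (\<lambda>k. (coef k)\<^sup>2)"
  and coef2_le: "(\<Sum>k. (coef k)\<^sup>2) \<le> N2"
  using bessel[OF u_L2] unfolding coef_def by auto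

lemma signal_summable: "summable (\<lambda>k. w k * (coef k)\<^sup>2)"
  by (rule summable_comparison_test'[OF coef2_summable])
    (auto simp: abs_mult w_abs(2) intro!: mult_left_le_one_le w_le less_imp_le[OF w_pos])

lemma signal_le: "signal \<le> N2"
proof -
  have "signal \<le> (\<Sum>k. (coef k)\<^sup>2)"
    unfolding signal_def
    by (intro suminf_le signal_summable coef2_summable mult_left_le_one_le w_le less_imp_le[OF w_pos]) auto
  with coef2_le show ?thesis by simp
qed

text \<open>Cauchy-Schwarz with \<open>w\<close> as the weights of the sum. The resulting factor
  \<open>sqrt signal\<close> is what later makes the second moment of \<open>proj\<close>
  proportional to \<open>signal\<close>.\<close>

lemma wcoef_suminf_le:
  assumes "signal > 0"
  shows "(\<Sum>k. \<bar>w k * coef k\<bar>) \<le> sqrt S * sqrt signal"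
proof -
  define p q where "p = sqrt signal" and "q = sqrt S"
  have pq: "p > 0" "q > 0" "p\<^sup>2 = signal" "q\<^sup>2 = S"
    using assms S_pos by (auto simp: p_def q_def)
  have "2 * (\<Sum>k. \<bar>w k * coef k\<bar>) = (\<Sum>k. 2 * \<bar>w k * coef k\<bar>)"
    by (rule suminf_mult[OF wcoef_summable, symmetric])
  also have "\<dots> \<le> (\<Sum>k. (q / p) * (w k * (coef k)\<^sup>2) + (p / q) * w k)"
  proof (intro suminf_le summable_add summable_mult wcoef_summable signal_summable w_summable)
    fix k
    have "2 * \<bar>coef k * 1\<bar> \<le> (q / p) * (coef k)\<^sup>2 + (p / q) * 1\<^sup>2"
      by (rule two_mult_abs_le[OF pq(1,2)])
    from mult_left_mono[OF this less_imp_le[OF w_pos[of k]]]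
    show "2 * \<bar>w k * coef k\<bar> \<le> (q / p) * (w k * (coef k)\<^sup>2) + (p / q) * w k"
      by (simp add: abs_mult w_abs(2) algebra_simps)
  qed
  also have "\<dots> = (q / p) * signal + (p / q) * S"
    unfolding signal_def
    by (subst suminf_add[symmetric], simp_all only: suminf_mult signal_summable w_summable summable_mult)
  also have "\<dots> = 2 * (q * p)"
    using pq(1,2) unfolding pq(3,4)[symmetric] by (simp add: field_simps power2_eq_square)
  finally show ?thesis by (simp add: p_def q_def)
qed

section \<open>Second moments of the projection and of the kernel\<close>

lemma proj_bound:
  assumes "signal > 0" "x \<in> space P0"
  shows "\<bar>proj x\<bar> \<le> sqrt S * sqrt signal * B"
proof -
  have "\<bar>proj x\<bar> \<le> (\<Sum>k. \<bar>w k * coef k\<bar>) * B"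
    unfolding proj_def by (intro abs_weighted_series_le(1) wcoef_summable phi_bound assms)
  also have "\<dots> \<le> sqrt S * sqrt signal * B"
    by (intro mult_right_mono wcoef_suminf_le assms B_nonneg)
  finally show ?thesis .
qed

text \<open>By orthonormality under \<open>P0\<close> the integral is the sum of
  \<open>(w k * coef k)\<^sup>2\<close>, and \<open>w k \<le> 1\<close> removes one factor
  \<open>w k\<close>. The square is expanded one factor at a time, so that each exchange concerns a
  single series.\<close>

lemma integral_proj_power2_le:
  assumes pos: "signal > 0"
  shows "(\<integral>x. (proj x)\<^sup>2 \<partial>P0) \<le> signal"
proof -
  define G where "G = sqrt S * sqrt signal * B"
  have bp: "\<bar>proj x\<bar> \<le> G" if "x \<in> space P0" for x
    unfolding G_def by (rule proj_bound[OF pos that])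
  have inner: "(\<integral>x. phi k x * proj x \<partial>P0) = w k * coef k" for k
  proof -
    have "(\<integral>x. phi k x * proj x \<partial>P0) = (\<integral>x. (\<Sum>l. w l * coef l * (phi k x * phi l x)) \<partial>P0)"
    proof (intro Bochner_Integration.integral_cong refl)
      fix x assume "x \<in> space P0"
      then have "summable (\<lambda>l. w l * coef l * phi l x)"
        by (intro summable_rabs_cancel[OF abs_weighted_series_le(2)[OF wcoef_summable phi_bound]])
      from suminf_mult[OF this, of "phi k x"]
      show "phi k x * proj x = (\<Sum>l. w l * coef l * (phi k x * phi l x))"
        by (simp add: proj_def mult_ac)
    qed
    also have "\<dots> = (\<Sum>l. w l * coef l * (\<integral>x. phi k x * phi l x \<partial>P0))"
      by (rule integral_weighted_series[where F = "\<lambda>_. B\<^sup>2"])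
        (auto simp: phi_mult_bound wcoef_summable)
    also have "\<dots> = (\<Sum>l. if l = k then w l * coef l else 0)"
      unfolding phi_orth by (intro suminf_cong) auto
    also have "\<dots> = w k * coef k"
      using sums_unique[OF sums_single[of k "\<lambda>l. w l * coef l"]] by simp
    finally show ?thesis .
  qed
  have "(\<integral>x. (proj x)\<^sup>2 \<partial>P0) = (\<integral>x. (\<Sum>k. w k * coef k * (phi k x * proj x)) \<partial>P0)"
  proof (intro Bochner_Integration.integral_cong refl)
    fix x assume "x \<in> space P0"
    then have "summable (\<lambda>l. w l * coef l * phi l x)"
      by (intro summable_rabs_cancel[OF abs_weighted_series_le(2)[OF wcoef_summable phi_bound]])
    from suminf_mult2[OF this, of "proj x"]
    show "(proj x)\<^sup>2 = (\<Sum>k. w k * coef k * (phi k x * proj x))"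
      by (simp add: proj_def mult_ac power2_eq_square)
  qed
  also have "\<dots> = (\<Sum>k. w k * coef k * (\<integral>x. phi k x * proj x \<partial>P0))"
    by (rule integral_weighted_series[where F = "\<lambda>_. B * G"])
        (auto simp: wcoef_summable abs_mult[of "phi _ _"] intro!: mult_mono phi_bound bp B_nonneg)
  also have "\<dots> = (\<Sum>k. w k * (w k * (coef k)\<^sup>2))"
    unfolding inner by (simp add: power2_eq_square mult_ac)
  also have "\<dots> \<le> signal"
    unfolding signal_def
  proof (intro suminf_le signal_summable)
    show le: "w k * (w k * (coef k)\<^sup>2) \<le> w k * (coef k)\<^sup>2" for k
      using w_pos[of k] by (intro mult_left_le_one_le w_le) auto
    show "summable (\<lambda>k. w k * (w k * (coef k)\<^sup>2))"
      using w_pos by (intro summable_comparison_test'[OF signal_summable]) (auto simp: le abs_mult w_abs(2))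
  qed
  finally show ?thesis .
qed

text \<open>Passing from \<open>P0\<close> to \<open>P\<close> adds the integral of
  \<open>(proj x)\<^sup>2 * u x\<close>. One factor \<open>proj\<close> is bounded uniformly and the
  other is paired with \<open>u\<close> by Cauchy-Schwarz; each contributes a
  \<open>sqrt signal\<close>, so the extra term is again a multiple of
  \<open>signal\<close>.\<close>

lemma expectation_proj_power2_le:
  assumes pos: "signal > 0"
  shows "(\<integral>x. (proj x)\<^sup>2 \<partial>P) \<le> signal * (1 + B * sqrt S * sqrt N2)"
proof -
  define G where "G = sqrt S * sqrt signal * B"
  have bp: "\<bar>proj x\<bar> \<le> G" if "x \<in> space P0" for x
    unfolding G_def by (rule proj_bound[OF pos that])
  have G0: "G \<ge> 0" unfolding G_def using B_nonneg S_pos pos by simp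
  have N: "N2 > 0" using signal_le pos by linarith
  have proj_L2: "proj \<in> L2 P0"
    unfolding L2_def using integrable_bounded[of "\<lambda>x. (proj x)\<^sup>2" "G\<^sup>2"] abs_power2_le[OF bp] by simp
  have ipu: "integrable P0 (\<lambda>x. proj x * u x)"
    by (rule integrable_L2_mult[OF proj_L2 u_L2])
  have [measurable]: "u \<in> borel_measurable P0" using u_L2 by (simp add: L2_def)
  have le: "\<bar>(proj x)\<^sup>2 * u x\<bar> \<le> G * \<bar>proj x * u x\<bar>" if "x \<in> space P0" for x
    using mult_right_mono[OF bp[OF that], of "\<bar>proj x * u x\<bar>"] by (simp add: abs_mult power2_eq_square mult.assoc)
  have "(\<integral>x. (proj x)\<^sup>2 * u x \<partial>P0) \<le> (\<integral>x. G * \<bar>proj x * u x\<bar> \<partial>P0)"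
  proof (rule integral_mono)
    show "integrable P0 (\<lambda>x. (proj x)\<^sup>2 * u x)"
    proof (rule Bochner_Integration.integrable_bound)
      show "integrable P0 (\<lambda>x. G * \<bar>proj x * u x\<bar>)" using ipu by auto
      show "AE x in P0. norm ((proj x)\<^sup>2 * u x) \<le> norm (G * \<bar>proj x * u x\<bar>)"
        using le G0 by (intro AE_I2) (simp add: abs_mult)
    qed measurable
  qed (use ipu le in \<open>auto intro: order_trans[OF abs_ge_self]\<close>)
  also have "\<dots> = G * (\<integral>x. \<bar>proj x * u x\<bar> \<partial>P0)" by simp
  also have "\<dots> \<le> G * (sqrt signal * sqrt N2)"
    using pos N integral_proj_power2_le[OF pos]
    by (intro mult_left_mono integral_abs_mult_le proj_L2 u_L2 G0) auto
  also have "\<dots> = signal * (B * sqrt S * sqrt N2)"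
    using pos by (simp add: G_def)
  finally have "(\<integral>x. (proj x)\<^sup>2 * u x \<partial>P0) \<le> signal * (B * sqrt S * sqrt N2)" .
  moreover have "(\<integral>x. (proj x)\<^sup>2 \<partial>P) = (\<integral>x. (proj x)\<^sup>2 \<partial>P0) + (\<integral>x. (proj x)\<^sup>2 * u x \<partial>P0)"
    by (intro integral_P[where C = "G\<^sup>2"] abs_power2_le bp) auto
  ultimately show ?thesis
    using integral_proj_power2_le[OF pos] by (simp add: algebra_simps)
qed

text \<open>The left side is the double sum of \<open>w k * w l * (m k l)\<^sup>2\<close>, where
  \<open>m\<close> is the Gram matrix of the \<open>phi k\<close> under \<open>P\<close>. It is the
  identity plus the Fourier coefficients of \<open>phi k * u\<close>, so each row is controlled by
  Bessel's inequality. The outcome is linear in \<open>S\<close>, whereas the pointwise bound on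
  \<open>kern\<close> would give \<open>S\<^sup>2\<close>.\<close>

lemma expectation_kern_power2_le:
  "(\<integral>x. (\<integral>y. (kern x y)\<^sup>2 \<partial>P) \<partial>P) \<le> S * (2 + 2 * B\<^sup>2 * N2)"
proof -
  define m where "m k l = (\<integral>x. phi k x * phi l x \<partial>P)" for k l
  define G where "G = (\<lambda>k x. \<Sum>l. w l * m k l * phi l x)"
  have bm: "\<bar>m k l\<bar> \<le> B\<^sup>2" for k l
    unfolding m_def by (intro P.abs_expectation_le phi_mult_bound) (auto simp: space_P)
  have wm: "summable (\<lambda>l. \<bar>w l * m k l\<bar>)" for k
    by (rule abs_weighted_series_le(2)[OF w_abs(1) bm])
  have bG: "\<bar>G k x\<bar> \<le> S * B\<^sup>2 * B" if x: "x \<in> space P0" for k x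
  proof -
    have "\<bar>\<Sum>l. w l * (m k l * phi l x)\<bar> \<le> (\<Sum>k. \<bar>w k\<bar>) * (B\<^sup>2 * B)"
      using bm phi_bound[OF x] by (intro abs_weighted_series_le(1) w_abs) (auto simp: abs_mult intro!: mult_mono)
    then show ?thesis by (simp add: G_def mult.assoc w_abs(2))
  qed
  have G_eq: "(\<integral>y. phi k y * kern x y \<partial>P) = G k x" if x: "x \<in> space P0" for k x
  proof -
    have "(\<integral>y. phi k y * kern x y \<partial>P) = (\<integral>y. (\<Sum>l. w l * (phi l x * (phi k y * phi l y))) \<partial>P)"
    proof (intro Bochner_Integration.integral_cong refl)
      fix y assume "y \<in> space P"
      then show "phi k y * kern x y = (\<Sum>l. w l * (phi l x * (phi k y * phi l y)))"
        using suminf_mult[OF sums_summable[OF kern_sums[OF x]], of y "phi k y", folded kern_def] by (simp add: space_P mult_ac)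
    qed
    also have "\<dots> = (\<Sum>l. w l * (\<integral>y. phi l x * (phi k y * phi l y) \<partial>P))"
      by (rule integral_weighted_series[where F = "\<lambda>_. B * B\<^sup>2"])
        (auto simp: w_abs(1) space_P abs_mult[of "phi _ x"] intro!: mult_mono phi_bound phi_mult_bound x B_nonneg)
    also have "\<dots> = (\<Sum>l. w l * (phi l x * m k l))"
      by (simp add: m_def)
    finally show ?thesis by (simp add: G_def mult_ac)
  qed
  have [measurable]: "G k \<in> borel_measurable P0" for k
    unfolding G_def by measurable
  have a_eq: "(\<integral>x. phi k x * G k x \<partial>P) = (\<Sum>l. w l * (m k l)\<^sup>2)" for k
  proof -
    have "(\<integral>x. phi k x * G k x \<partial>P) = (\<integral>x. (\<Sum>l. w l * m k l * (phi k x * phi l x)) \<partial>P)"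
    proof (intro Bochner_Integration.integral_cong refl)
      fix x assume "x \<in> space P"
      then have "summable (\<lambda>l. w l * m k l * phi l x)"
        by (intro summable_rabs_cancel[OF abs_weighted_series_le(2)[OF wm phi_bound]]) (simp add: space_P)
      from suminf_mult[OF this, of "phi k x"]
      show "phi k x * G k x = (\<Sum>l. w l * m k l * (phi k x * phi l x))"
        by (simp add: G_def mult_ac)
    qed
    also have "\<dots> = (\<Sum>l. w l * m k l * (\<integral>x. phi k x * phi l x \<partial>P))"
      by (rule integral_weighted_series[where F = "\<lambda>_. B\<^sup>2"])
        (auto simp: wm space_P phi_mult_bound)
    finally show ?thesis by (simp add: m_def power2_eq_square mult_ac)
  qed
  have a_le: "(\<Sum>l. w l * (m k l)\<^sup>2) \<le> 2 + 2 * B\<^sup>2 * N2" and a_nonneg: "0 \<le> (\<Sum>l. w l * (m k l)\<^sup>2)" for k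
  proof -
    define f where "f = (\<lambda>x. phi k x * u x)"
    have [measurable]: "u \<in> borel_measurable P0" using u_L2 by (simp add: L2_def)
    have f2: "(f x)\<^sup>2 \<le> B\<^sup>2 * (u x)\<^sup>2" if "x \<in> space P0" for x
      unfolding f_def power_mult_distrib
      by (intro mult_right_mono power2_le_of_abs_le phi_bound that) auto
    have iu: "integrable P0 (\<lambda>x. B\<^sup>2 * (u x)\<^sup>2)" using u_L2 by (simp add: L2_def)
    have f_meas: "f \<in> borel_measurable P0" unfolding f_def by measurable
    have f_L2: "f \<in> L2 P0"
      unfolding L2_def using f_meas f2
      by (auto intro!: Bochner_Integration.integrable_bound[OF iu] AE_I2)
    have "(\<integral>x. (f x)\<^sup>2 \<partial>P0) \<le> (\<integral>x. B\<^sup>2 * (u x)\<^sup>2 \<partial>P0)"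
      using f_L2 iu f2 by (intro integral_mono) (auto simp: L2_def)
    then have fN: "(\<integral>x. (f x)\<^sup>2 \<partial>P0) \<le> B\<^sup>2 * N2" by simp
    let ?b = "\<lambda>l. L2_inner P0 f (phi l)"
    have m_eq: "m k l = (if k = l then 1 else 0) + ?b l" for l
    proof -
      have "m k l = (\<integral>x. phi k x * phi l x \<partial>P0) + (\<integral>x. phi k x * phi l x * u x \<partial>P0)"
        unfolding m_def by (rule integral_P[where C = "B\<^sup>2"]) (auto simp: phi_mult_bound)
      then show ?thesis by (simp add: phi_orth L2_inner_def f_def mult_ac)
    qed
    \<comment> \<open>The inner weight is discarded here; the single factor \<open>S\<close> comes
      from the outer sum over \<open>k\<close>.\<close>
    have le: "w l * (m k l)\<^sup>2 \<le> (if l = k then 2 else 0) + 2 * (?b l)\<^sup>2" for l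
    proof -
      have "w l * (m k l)\<^sup>2 \<le> (m k l)\<^sup>2"
        using w_pos[of l] by (intro mult_left_le_one_le w_le) auto
      also have "\<dots> \<le> 2 * (if k = l then 1 else 0)\<^sup>2 + 2 * (?b l)\<^sup>2"
        unfolding m_eq power2_sum
        using sum_squares_bound[of "(if k = l then 1 else 0)" "?b l"] by linarith
      finally show ?thesis by (auto split: if_splits)
    qed
    have s1: "(\<lambda>l. (if l = k then 2 else 0) + 2 * (?b l)\<^sup>2) sums (2 + 2 * (\<Sum>l. (?b l)\<^sup>2))"
      using sums_add[OF sums_single[of k "\<lambda>_. 2"] sums_mult[OF summable_sums[OF bessel(1)[OF f_L2]], of 2]] .
    have s2: "summable (\<lambda>l. w l * (m k l)\<^sup>2)"
      using le w_pos by (intro summable_comparison_test'[OF sums_summable[OF s1]]) (auto simp: abs_mult w_abs(2))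
    have "(\<Sum>l. w l * (m k l)\<^sup>2) \<le> 2 + 2 * (\<Sum>l. (?b l)\<^sup>2)"
      unfolding sums_unique[OF s1] by (intro suminf_le le s2 sums_summable[OF s1])
    also have "\<dots> \<le> 2 + 2 * B\<^sup>2 * N2"
      using bessel(2)[OF f_L2] fN by simp
    finally show "(\<Sum>l. w l * (m k l)\<^sup>2) \<le> 2 + 2 * B\<^sup>2 * N2" .
    show "0 \<le> (\<Sum>l. w l * (m k l)\<^sup>2)"
      using w_pos by (intro suminf_nonneg s2) (auto simp: less_imp_le)
  qed
  have "(\<integral>x. (\<integral>y. (kern x y)\<^sup>2 \<partial>P) \<partial>P) = (\<integral>x. (\<Sum>k. w k * (phi k x * G k x)) \<partial>P)"
  proof (intro Bochner_Integration.integral_cong refl)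
    fix x assume "x \<in> space P"
    then have x: "x \<in> space P0" by (simp add: space_P)
    have "(\<integral>y. (kern x y)\<^sup>2 \<partial>P) = (\<integral>y. (\<Sum>k. w k * (phi k x * (phi k y * kern x y))) \<partial>P)"
    proof (intro Bochner_Integration.integral_cong refl)
      fix y assume "y \<in> space P"
      then show "(kern x y)\<^sup>2 = (\<Sum>k. w k * (phi k x * (phi k y * kern x y)))"
        using suminf_mult2[OF sums_summable[OF kern_sums[OF x]], of y "kern x y", folded kern_def]
        by (simp add: power2_eq_square space_P mult.assoc)
    qed
    also have "\<dots> = (\<Sum>k. w k * (\<integral>y. phi k x * (phi k y * kern x y) \<partial>P))"
      by (rule integral_weighted_series[where F = "\<lambda>_. B * (B * (S * B\<^sup>2))"])
        (auto simp: w_abs(1) space_P abs_mult intro!: mult_mono phi_bound kern_bound x B_nonneg)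
    finally show "(\<integral>y. (kern x y)\<^sup>2 \<partial>P) = (\<Sum>k. w k * (phi k x * G k x))"
      using G_eq[OF x] by simp
  qed
  also have "\<dots> = (\<Sum>k. w k * (\<integral>x. phi k x * G k x \<partial>P))"
    by (rule integral_weighted_series[where F = "\<lambda>_. B * (S * B\<^sup>2 * B)"])
        (auto simp: w_abs(1) space_P abs_mult intro!: mult_mono phi_bound bG B_nonneg)
  also have "\<dots> = (\<Sum>k. w k * (\<Sum>l. w l * (m k l)\<^sup>2))"
    unfolding a_eq ..
  also have "\<dots> \<le> (\<Sum>k. \<bar>w k\<bar>) * (2 + 2 * B\<^sup>2 * N2)"
    by (rule order_trans[OF abs_ge_self abs_weighted_series_le(1)[OF w_abs(1)]])
      (simp add: a_le a_nonneg)
  finally show ?thesis by (simp add: w_abs(2))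
qed

lemma expectation_U_kern_power2_le:
  assumes "signal > 0"
  shows "(\<integral>X. ((\<Sum>i<n. \<Sum>j<i. kern (X i) (X j)) - real n * (real n - 1) / 2 * signal)\<^sup>2 \<partial>PiM {..<n} (\<lambda>_. P))
    \<le> real n ^ 2 * (S * (2 + 2 * B\<^sup>2 * N2)) + 2 * real n ^ 3 * (signal * (1 + B * sqrt S * sqrt N2))"
proof -
  have proj: "(\<integral>x. f (\<integral>y. kern x y \<partial>P) \<partial>P) = (\<integral>x. f (proj x) \<partial>P)" for f :: "real \<Rightarrow> real"
    by (intro Bochner_Integration.integral_cong refl) (simp add: expectation_kern space_P)
  have "(\<integral>X. ((\<Sum>i<n. \<Sum>j<i. kern (X i) (X j)) - real n * (real n - 1) / 2 * signal)\<^sup>2 \<partial>PiM {..<n} (\<lambda>_. P))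
    \<le> real n ^ 2 * (\<integral>x. (\<integral>y. (kern x y)\<^sup>2 \<partial>P) \<partial>P) + 2 * real n ^ 3 * (\<integral>x. (proj x)\<^sup>2 \<partial>P)"
    using P.expectation_U_statistic_power2_le[of kern "S * B\<^sup>2" n] proj[of "\<lambda>x. x"] proj[of power2] kern_bound
    by (simp add: space_P expectation_proj) (simp add: kern_def mult.commute)
  also have "\<dots> \<le> real n ^ 2 * (S * (2 + 2 * B\<^sup>2 * N2)) + 2 * real n ^ 3 * (signal * (1 + B * sqrt S * sqrt N2))"
    by (intro add_mono mult_left_mono expectation_kern_power2_le expectation_proj_power2_le assms) auto
  finally show ?thesis .
qed

end

subsection \<open>Effective dimension and bias\<close>

text \<open>The mean value theorem for the power \<open>1 - p\<close>. It replaces the integral test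
  by a telescoping sum.\<close>

lemma powr_telescope_le:
  fixes x p :: real
  assumes x: "x > 0" and p: "p > 1"
  shows "(x + 1) powr (-p) \<le> (x powr (1 - p) - (x + 1) powr (1 - p)) / (p - 1)"
proof -
  have "\<exists>z. x < z \<and> z < x + 1 \<and>
      (x + 1) powr (1 - p) - x powr (1 - p) = (x + 1 - x) * ((1 - p) * z powr (1 - p - 1))"
    using x by (intro MVT2) (auto intro!: derivative_eq_intros)
  then obtain z where z: "x < z" "z < x + 1"
    "(x + 1) powr (1 - p) - x powr (1 - p) = (1 - p) * z powr (- p)" by auto
  have "(x + 1) powr (-p) \<le> z powr (-p)"
    using z x p by (intro powr_mono2') auto
  then have "(p - 1) * (x + 1) powr (-p) \<le> (p - 1) * z powr (-p)"
    using p by (intro mult_left_mono) auto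
  also have "\<dots> = x powr (1 - p) - (x + 1) powr (1 - p)"
    using z(3) by (simp add: algebra_simps)
  finally show ?thesis using p by (simp add: field_simps)
qed

lemma sum_powr_tail_le:
  fixes p :: real
  assumes p: "p > 1" and N: "N > 0"
  shows "(\<Sum>k<m. real (N + k + 1) powr (-p)) \<le> real N powr (1 - p) / (p - 1)"
proof -
  have "(\<Sum>k<m. real (N + k + 1) powr (-p)) \<le> (real N powr (1 - p) - real (N + m) powr (1 - p)) / (p - 1)"
  proof (induction m)
    case (Suc m)
    have "real (N + m + 1) powr (-p) \<le> (real (N + m) powr (1 - p) - real (N + m + 1) powr (1 - p)) / (p - 1)"
      using powr_telescope_le[of "real (N + m)" p] p N by (simp add: add.commute add.left_commute)
    with Suc show ?case by (simp add: diff_divide_distrib add_ac)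
  qed simp
  also have "\<dots> \<le> real N powr (1 - p) / (p - 1)"
    using p by (intro divide_right_mono) auto
  finally show ?thesis .
qed

text \<open>Splitting at \<open>N \<approx> \<rho> powr (-1/s)\<close>: below it the weights are bounded by \<open>1\<close>, above it
  by \<open>lam k / \<rho>\<^sup>2\<close>.\<close>

lemma effective_dimension_le:
  fixes lam :: "nat \<Rightarrow> real"
  assumes s: "s > 1/2" and pos: "\<And>k. lam k > 0"
    and le: "\<And>k. lam k \<le> A * real (Suc k) powr (- (2 * s))"
    and \<rho>: "0 < \<rho>" "\<rho> \<le> c"
  shows "summable (\<lambda>k. lam k / (lam k + \<rho>\<^sup>2))"
    and "(\<Sum>k. lam k / (lam k + \<rho>\<^sup>2)) \<le> (1 + c powr (1/s) + A / (2 * s - 1)) * \<rho> powr (-1/s)"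
proof -
  define w where "w k = lam k / (lam k + \<rho>\<^sup>2)" for k
  define a where "a = \<rho> powr (-1/s)"
  define N where "N = nat \<lceil>a\<rceil>"
  have a0: "a > 0" using \<rho> by (simp add: a_def)
  have N: "N > 0" "a \<le> real N" "real N \<le> a + 1"
    using a0 unfolding N_def by linarith+
  have A0: "A \<ge> 0" using le[of 0] pos[of 0] by simp
  have den: "lam k + \<rho>\<^sup>2 > 0" for k using pos[of k] \<rho> by (intro add_pos_pos) auto
  have w0: "w k \<ge> 0" for k using pos[of k] den[of k] by (simp add: w_def)
  have w1: "w k \<le> 1" for k using den[of k] \<rho> by (simp add: w_def)
  have w2: "w k \<le> A / \<rho>\<^sup>2 * real (k + 1) powr (- (2 * s))" for k
  proof -
    have "w k \<le> lam k / \<rho>\<^sup>2"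
      unfolding w_def using pos[of k] \<rho> by (intro divide_left_mono) (auto intro!: mult_pos_pos add_pos_pos)
    also have "\<dots> \<le> A * real (Suc k) powr (- (2 * s)) / \<rho>\<^sup>2"
      using le[of k] \<rho> by (intro divide_right_mono) auto
    finally show ?thesis by simp
  qed
  \<comment> \<open>The exponent is negative, so rounding \<open>a\<close> up to \<open>N\<close> is
    harmless. The cut-off is chosen so that \<open>a powr (- (2 * s)) = \<rho>\<^sup>2\<close>,
    which makes the tail bound of the same order as the head.\<close>
  have Npow: "real N powr (1 - 2 * s) \<le> a * \<rho>\<^sup>2"
  proof -
    have "real N powr (1 - 2 * s) \<le> a powr (1 - 2 * s)"
      using s a0 N by (intro powr_mono2') auto
    also have "\<dots> = \<rho> powr (-1/s + 2)"
    proof -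
      have "-1/s * (1 - 2 * s) = -1/s + 2" using s by (simp add: field_simps)
      then show ?thesis unfolding a_def powr_powr by simp
    qed
    also have "\<dots> = a * \<rho>\<^sup>2"
      using \<rho> unfolding a_def powr_add by simp
    finally show ?thesis .
  qed
  \<comment> \<open>Rounding up costs an additive 1; since \<open>\<rho> \<le> c\<close>, it is
    absorbed into a multiple of \<open>a\<close>.\<close>
  have a1: "1 \<le> c powr (1/s) * a"
  proof -
    have "c powr (1/s) * a = (c / \<rho>) powr (1/s)"
      using \<rho> s unfolding a_def by (simp add: powr_divide powr_minus field_simps)
    also have "\<dots> \<ge> 1" using \<rho> s by (intro ge_one_powr_ge_zero) auto
    finally show ?thesis .
  qed
  have part: "(\<Sum>k<m. w k) \<le> (1 + c powr (1/s) + A / (2 * s - 1)) * a" for m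
  proof -
    have "(\<Sum>k<m. w k) \<le> (\<Sum>k<N + m. w k)"
      using w0 by (intro sum_mono2) auto
    also have "\<dots> = (\<Sum>k<N. w k) + (\<Sum>k<m. w (N + k))"
      by (induction m) auto
    also have "(\<Sum>k<N. w k) \<le> real N"
      using sum_bounded_above[of "{..<N}" w 1] w1 by simp
    also have "(\<Sum>k<m. w (N + k)) \<le> (\<Sum>k<m. A / \<rho>\<^sup>2 * real (N + k + 1) powr (- (2 * s)))"
      by (intro sum_mono w2)
    also have "\<dots> = A / \<rho>\<^sup>2 * (\<Sum>k<m. real (N + k + 1) powr (- (2 * s)))"
      by (simp add: sum_distrib_left)
    also have "\<dots> \<le> A / \<rho>\<^sup>2 * (real N powr (1 - 2 * s) / (2 * s - 1))"
      using s N A0 by (intro mult_left_mono sum_powr_tail_le) auto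
    also have "\<dots> \<le> A / \<rho>\<^sup>2 * (a * \<rho>\<^sup>2 / (2 * s - 1))"
      using Npow s A0 by (intro mult_left_mono divide_right_mono) auto
    also have "\<dots> = A / (2 * s - 1) * a"
      using \<rho> by simp
    also have "real N \<le> a + c powr (1/s) * a" using N(3) a1 by linarith
    finally show ?thesis by (simp add: algebra_simps)
  qed
  have "summable w"
    using w0 part by (rule summableI_nonneg_bounded)
  then show "summable (\<lambda>k. lam k / (lam k + \<rho>\<^sup>2))"
    and "(\<Sum>k. lam k / (lam k + \<rho>\<^sup>2)) \<le> (1 + c powr (1/s) + A / (2 * s - 1)) * \<rho> powr (-1/s)"
    using suminf_le_const[OF \<open>summable w\<close> part] unfolding w_def a_def by auto
qed

text \<open>Of the eigenvalue decay only summability is kept here; the polynomial rate enters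
  through \<open>effective_dimension_le\<close>.\<close>

locale mercer_system = bounded_orthonormal P0 phi B for P0 :: "'a measure" and phi B +
  fixes lam :: "nat \<Rightarrow> real"
  assumes lam_pos: "\<And>k. lam k > 0" and lam_summable: "summable lam"
    and phi_complete: "\<And>f. f \<in> L2 P0 \<Longrightarrow> (\<integral>x. f x \<partial>P0) = 0 \<Longrightarrow> (\<And>k. L2_inner P0 f (phi k) = 0)
      \<Longrightarrow> AE x in P0. f x = 0"
begin

text \<open>Coefficients of an RKHS function are absolutely summable and the \<open>phi k\<close> uniformly bounded, so
  the expansion converges uniformly and no completeness of \<open>L2\<close> is involved.\<close>

lemma parseval_RKHS:
  assumes "in_RKHS P0 lam phi f"
  shows "(\<integral>x. (f x)\<^sup>2 \<partial>P0) = (\<Sum>k. (L2_inner P0 f (phi k))\<^sup>2)"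
proof -
  define c where "c k = L2_inner P0 f (phi k)" for k
  have f: "f \<in> L2 P0" "(\<integral>x. f x \<partial>P0) = 0" and sc: "summable (\<lambda>k. (c k)\<^sup>2 / lam k)"
    using assms by (auto simp: in_RKHS_def c_def)
  have [measurable]: "f \<in> borel_measurable P0" using f by (simp add: L2_def)
  \<comment> \<open>The arithmetic-geometric inequality bounds \<open>2 * \<bar>c k\<bar>\<close> by
    \<open>(c k)\<^sup>2 / lam k + lam k\<close>, the general term of a sum of two convergent
    series.\<close>
  have c_abs: "summable (\<lambda>k. \<bar>c k\<bar>)"
  proof (rule summable_comparison_test'[OF summable_add[OF sc lam_summable]])
    fix k
    have "2 * \<bar>c k\<bar> * lam k \<le> (c k)\<^sup>2 + (lam k)\<^sup>2"
      using sum_squares_bound[of "\<bar>c k\<bar>" "lam k"] by simp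
    then have "2 * \<bar>c k\<bar> \<le> (c k)\<^sup>2 / lam k + lam k"
      using lam_pos[of k] by (simp add: field_simps power2_eq_square)
    then show "norm \<bar>c k\<bar> \<le> (c k)\<^sup>2 / lam k + lam k" by simp
  qed
  define g where "g x = (\<Sum>k. c k * phi k x)" for x
  have [measurable]: "g \<in> borel_measurable P0" unfolding g_def by measurable
  have bg: "\<bar>g x\<bar> \<le> (\<Sum>k. \<bar>c k\<bar>) * B" if "x \<in> space P0" for x
    unfolding g_def by (rule abs_weighted_series_le(1)[OF c_abs phi_bound[OF that]])
  have ig: "integrable P0 g" by (rule integrable_bounded[OF _ bg]) auto
  have g_L2: "g \<in> L2 P0"
    unfolding L2_def
    using integrable_bounded[of "\<lambda>x. (g x)\<^sup>2", OF _ abs_power2_le[OF bg]] by simp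
  have one_L2: "(\<lambda>x. 1) \<in> L2 P0" by (simp add: L2_def)
  have if': "integrable P0 f"
    using integrable_L2_mult[OF f(1) one_L2] by simp
  have inner: "(\<integral>x. h x * g x \<partial>P0) = (\<Sum>k. c k * (\<integral>x. h x * phi k x \<partial>P0))" if h: "h \<in> L2 P0" for h
  proof -
    have [measurable]: "h \<in> borel_measurable P0" using h by (simp add: L2_def)
    have "(\<integral>x. h x * g x \<partial>P0) = (\<integral>x. (\<Sum>k. c k * (h x * phi k x)) \<partial>P0)"
    proof (intro Bochner_Integration.integral_cong refl)
      fix x assume "x \<in> space P0"
      then have "summable (\<lambda>k. c k * phi k x)"
        by (intro summable_rabs_cancel[OF abs_weighted_series_le(2)[OF c_abs phi_bound]])
      from suminf_mult[OF this, of "h x"]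
      show "h x * g x = (\<Sum>k. c k * (h x * phi k x))"
        by (simp add: g_def mult_ac)
    qed
    also have "\<dots> = (\<Sum>k. c k * (\<integral>x. h x * phi k x \<partial>P0))"
    proof (rule integral_weighted_series[where F = "\<lambda>x. \<bar>h x\<bar> * B"])
      show "integrable P0 (\<lambda>x. \<bar>h x\<bar> * B)"
        using integrable_L2_mult[OF h one_L2] by auto
    qed (auto simp: c_abs abs_mult intro!: mult_left_mono phi_bound)
    finally show ?thesis .
  qed
  \<comment> \<open>The difference has mean zero and the same coefficients as the zero function, so
    completeness of the \<open>phi k\<close> identifies \<open>f\<close> with its uniformly
    convergent expansion.\<close>
  have "AE x in P0. f x - g x = 0"
  proof (rule phi_complete)
    show "(\<lambda>x. f x - g x) \<in> L2 P0" by (rule L2_diff[OF f(1) g_L2])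
    show "(\<integral>x. f x - g x \<partial>P0) = 0"
      using if' ig f(2) inner[OF one_L2] by (simp add: phi_mean)
    fix j
    have "(\<integral>x. phi j x * g x \<partial>P0) = (\<Sum>k. if k = j then c k else 0)"
      unfolding inner[OF phi_L2] phi_orth by (intro suminf_cong) auto
    also have "\<dots> = c j"
      using sums_unique[OF sums_single[of j c]] by simp
    finally show "L2_inner P0 (\<lambda>x. f x - g x) (phi j) = 0"
      using integrable_L2_mult[OF f(1) phi_L2] integrable_L2_mult[OF g_L2 phi_L2]
      by (simp add: L2_inner_def c_def left_diff_distrib mult.commute[of "phi j _"])
  qed
  then have "(\<integral>x. (f x)\<^sup>2 \<partial>P0) = (\<integral>x. f x * g x \<partial>P0)"
    by (intro integral_cong_AE) (auto simp: power2_eq_square)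
  also have "\<dots> = (\<Sum>k. (c k)\<^sup>2)"
    unfolding inner[OF f(1)] by (simp add: c_def L2_inner_def power2_eq_square)
  finally show ?thesis by (simp add: c_def)
qed

text \<open>Write \<open>N\<close> for the squared norm of \<open>u\<close>. Since
  \<open>w k \<ge> 1 - \<rho>\<^sup>2 / lam k\<close>, weighting the coefficients of
  \<open>f\<close> loses at most the left side of \<open>smooth\<close>, that is
  \<open>N / 16\<close>. The squared norm of \<open>f\<close> is at least
  \<open>N / 2 - N / 16\<close>, so the weighted sum for \<open>f\<close> is at least
  \<open>3 * N / 8\<close>. It is at most twice the sum for \<open>u\<close> plus twice the
  approximation error, that is plus \<open>N / 8\<close>, which leaves \<open>N / 8\<close> for
  \<open>u\<close>.\<close>

lemma weighted_coef_sum_ge: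
  assumes u: "u \<in> L2 P0" and f: "in_RKHS P0 lam phi f" and \<rho>: "\<rho> > 0"
    and approx: "(\<integral>x. (u x - f x)\<^sup>2 \<partial>P0) \<le> (\<integral>x. (u x)\<^sup>2 \<partial>P0) / 16"
    and smooth: "\<rho>\<^sup>2 * (\<Sum>k. (L2_inner P0 f (phi k))\<^sup>2 / lam k) \<le> (\<integral>x. (u x)\<^sup>2 \<partial>P0) / 16"
  shows "(\<integral>x. (u x)\<^sup>2 \<partial>P0) / 8 \<le> (\<Sum>k. lam k / (lam k + \<rho>\<^sup>2) * (L2_inner P0 u (phi k))\<^sup>2)"
proof -
  let ?N = "\<integral>x. (u x)\<^sup>2 \<partial>P0"
  define w where "w k = lam k / (lam k + \<rho>\<^sup>2)" for k
  define a where "a k = L2_inner P0 u (phi k)" for k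
  define b where "b k = L2_inner P0 f (phi k)" for k
  define d where "d k = L2_inner P0 (\<lambda>x. u x - f x) (phi k)" for k
  have f2: "f \<in> L2 P0" and sb: "summable (\<lambda>k. (b k)\<^sup>2 / lam k)"
    using f by (auto simp: in_RKHS_def b_def)
  note uf = L2_diff[OF u f2]
  have den: "lam k + \<rho>\<^sup>2 > 0" for k using lam_pos[of k] \<rho> by (intro add_pos_pos) auto
  have w0: "w k \<ge> 0" for k using lam_pos[of k] den[of k] by (simp add: w_def)
  have w1: "w k \<le> 1" for k using den[of k] \<rho> by (simp add: w_def)
  have d_eq: "d k = a k - b k" for k
    unfolding d_def a_def b_def L2_inner_def
    using integrable_L2_mult[OF u phi_L2] integrable_L2_mult[OF f2 phi_L2] by (simp add: left_diff_distrib)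
  have sq: "(x::real)\<^sup>2 \<le> 2 * y\<^sup>2 + 2 * (y - x)\<^sup>2" for x y
    using zero_le_power2[of "2 * y - x"] by (simp add: power2_eq_square algebra_simps)
  have pt: "(b k)\<^sup>2 - \<rho>\<^sup>2 * ((b k)\<^sup>2 / lam k) \<le> 2 * (w k * (a k)\<^sup>2) + 2 * (d k)\<^sup>2" for k
  proof -
    have "1 - \<rho>\<^sup>2 / lam k \<le> w k"
    proof -
      have "\<rho>\<^sup>2 / (lam k + \<rho>\<^sup>2) \<le> \<rho>\<^sup>2 / lam k"
        using lam_pos[of k] \<rho> by (intro divide_left_mono) (auto intro!: mult_pos_pos add_pos_pos)
      moreover have "w k + \<rho>\<^sup>2 / (lam k + \<rho>\<^sup>2) = 1"
        using den[of k] unfolding w_def add_divide_distrib[symmetric] by simp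
      ultimately show ?thesis by linarith
    qed
    from mult_right_mono[OF this, of "(b k)\<^sup>2"]
    have "(b k)\<^sup>2 - \<rho>\<^sup>2 * ((b k)\<^sup>2 / lam k) \<le> w k * (b k)\<^sup>2"
      by (simp add: left_diff_distrib)
    also have "\<dots> \<le> w k * (2 * (a k)\<^sup>2 + 2 * (d k)\<^sup>2)"
      unfolding d_eq by (intro mult_left_mono sq w0)
    also have "\<dots> = 2 * (w k * (a k)\<^sup>2) + 2 * (w k * (d k)\<^sup>2)"
      by (simp add: algebra_simps)
    also have "\<dots> \<le> 2 * (w k * (a k)\<^sup>2) + 2 * (d k)\<^sup>2"
      using mult_left_le_one_le[OF _ w0 w1, of "(d k)\<^sup>2"] by simp
    finally show ?thesis .
  qed
  have sa: "summable (\<lambda>k. w k * (a k)\<^sup>2)"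
    using w0 w1 unfolding a_def
    by (intro summable_comparison_test'[OF bessel(1)[OF u]]) (auto simp: abs_mult intro!: mult_left_le_one_le)
  have sb2: "summable (\<lambda>k. (b k)\<^sup>2)" unfolding b_def by (rule bessel(1)[OF f2])
  have sd2: "summable (\<lambda>k. (d k)\<^sup>2)" unfolding d_def by (rule bessel(1)[OF uf])
  have "(\<Sum>k. (b k)\<^sup>2 - \<rho>\<^sup>2 * ((b k)\<^sup>2 / lam k)) \<le> (\<Sum>k. 2 * (w k * (a k)\<^sup>2) + 2 * (d k)\<^sup>2)"
    by (intro suminf_le pt summable_diff summable_add summable_mult sa sb sb2 sd2)
  moreover have "(\<Sum>k. (b k)\<^sup>2 - \<rho>\<^sup>2 * ((b k)\<^sup>2 / lam k)) = (\<Sum>k. (b k)\<^sup>2) - \<rho>\<^sup>2 * (\<Sum>k. (b k)\<^sup>2 / lam k)"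
    using suminf_diff[OF sb2 summable_mult[OF sb, of "\<rho>\<^sup>2"]] suminf_mult[OF sb, of "\<rho>\<^sup>2"] by simp
  moreover have "(\<Sum>k. 2 * (w k * (a k)\<^sup>2) + 2 * (d k)\<^sup>2) = 2 * (\<Sum>k. w k * (a k)\<^sup>2) + 2 * (\<Sum>k. (d k)\<^sup>2)"
    using suminf_add[OF summable_mult[OF sa, of 2] summable_mult[OF sd2, of 2]]
      suminf_mult[OF sa, of 2] suminf_mult[OF sd2, of 2] by simp
  moreover have "(\<Sum>k. (d k)\<^sup>2) \<le> ?N / 16"
    using bessel(2)[OF uf] approx unfolding d_def by linarith
  moreover have "(\<Sum>k. (b k)\<^sup>2) = (\<integral>x. (f x)\<^sup>2 \<partial>P0)"
    unfolding b_def by (rule parseval_RKHS[OF f, symmetric])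
  moreover have "?N \<le> 2 * (\<integral>x. (f x)\<^sup>2 \<partial>P0) + 2 * (\<integral>x. (u x - f x)\<^sup>2 \<partial>P0)"
  proof -
    have "?N \<le> (\<integral>x. 2 * (f x)\<^sup>2 + 2 * (u x - f x)\<^sup>2 \<partial>P0)"
    proof (rule integral_mono)
      show "integrable P0 (\<lambda>x. 2 * (f x)\<^sup>2 + 2 * (u x - f x)\<^sup>2)"
        using f2 uf by (simp add: L2_def)
      fix x
      show "(u x)\<^sup>2 \<le> 2 * (f x)\<^sup>2 + 2 * (u x - f x)\<^sup>2"
        using sq[of "u x" "f x"] by (simp add: power2_commute)
    qed (use u in \<open>simp add: L2_def\<close>)
    then show ?thesis using f2 uf by (simp add: L2_def)
  qed
  ultimately show ?thesis
    using approx smooth unfolding w_def a_def b_def by linarith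
qed

end

subsection \<open>Type II error\<close>

lemma sum_power2_split:
  fixes a :: "nat \<Rightarrow> real"
  shows "(\<Sum>i<n. a i)\<^sup>2 = (\<Sum>i<n. a i * a i) + 2 * (\<Sum>i<n. \<Sum>j<i. a i * a j)"
  by (induction n) (auto simp: power2_eq_square algebra_simps sum_distrib_left)

context density_alternative
begin

text \<open>Squaring the empirical means produces a diagonal that \<open>A_n\<close> cancels
  exactly, so only pairs of distinct observations remain, each counted twice.\<close>

lemma statistic_eq:
  assumes X: "\<And>i. i < n \<Longrightarrow> X i \<in> space P0" and n: "n > 0"
    and w: "\<And>k. w k = lam k / (lam k + \<rho>\<^sup>2)"
  shows "real n * eta2 lam phi \<rho> n X - A_n lam phi \<rho> n X = 2 / real n * (\<Sum>i<n. \<Sum>j<i. kern (X i) (X j))"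
proof -
  have "(\<lambda>k. (1 / real n)\<^sup>2 * ((\<Sum>i<n. w k * (phi k (X i) * phi k (X i))) +
          2 * (\<Sum>i<n. \<Sum>j<i. w k * (phi k (X i) * phi k (X j)))))
      sums ((1 / real n)\<^sup>2 * ((\<Sum>i<n. kern (X i) (X i)) + 2 * (\<Sum>i<n. \<Sum>j<i. kern (X i) (X j))))"
    by (intro sums_mult sums_add sums_sum kern_sums X) auto
  moreover have "(1 / real n)\<^sup>2 * ((\<Sum>i<n. w k * (phi k (X i) * phi k (X i))) +
          2 * (\<Sum>i<n. \<Sum>j<i. w k * (phi k (X i) * phi k (X j))))
      = w k * ((1 / real n) * (\<Sum>i<n. phi k (X i)))\<^sup>2" for k
    unfolding power_mult_distrib sum_power2_split
    by (simp add: sum_distrib_left[symmetric] algebra_simps)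
  ultimately have eta: "eta2 lam phi \<rho> n X =
      (1 / real n)\<^sup>2 * ((\<Sum>i<n. kern (X i) (X i)) + 2 * (\<Sum>i<n. \<Sum>j<i. kern (X i) (X j)))"
    unfolding eta2_def w[symmetric] by (simp add: sums_iff)
  have "A_n lam phi \<rho> n X = (1 / real n) * (\<Sum>i<n. kern (X i) (X i))"
    unfolding A_n_def Ktilde_def kern_def w by (simp add: mult.assoc)
  then show ?thesis
    unfolding eta using n by (simp add: field_simps power2_eq_square)
qed

lemma v_n_bounds:
  assumes w: "\<And>k. w k = lam k / (lam k + \<rho>\<^sup>2)"
  shows "v_n lam \<rho> > 0" "v_n lam \<rho> \<le> S"
proof -
  have le: "(w k)\<^sup>2 \<le> w k" for k
    unfolding power2_eq_square using w_pos[of k] by (intro mult_left_le_one_le w_le) auto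
  have s: "summable (\<lambda>k. (w k)\<^sup>2)"
    by (rule summable_comparison_test'[OF w_summable]) (simp add: le)
  show "v_n lam \<rho> > 0"
    unfolding v_n_def w[symmetric] using w_pos by (intro suminf_pos s) (simp add: less_imp_neq[symmetric])
  show "v_n lam \<rho> \<le> S"
    unfolding v_n_def w[symmetric] by (intro suminf_le le s w_summable)
qed

text \<open>The pair sum \<open>V\<close> is \<open>n / 2\<close> times the centred statistic, hence
  the factor on the threshold. Acceptance forces \<open>V\<close> below its mean by at least
  \<open>g\<close>, so the acceptance indicator is dominated pointwise by
  \<open>(V X - m)\<^sup>2 / g\<^sup>2\<close>.\<close>

lemma chebyshev_typeII:
  assumes n: "n > 0" and w: "\<And>k. w k = lam k / (lam k + \<rho>\<^sup>2)" and pos: "signal > 0"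
    and g: "g > 0" "g + real n / 2 * (\<bar>std_normal_quantile (1 - \<alpha>)\<bar> * sqrt (2 * S))
      \<le> real n * (real n - 1) / 2 * signal"
  shows "(\<integral>X. 1 - T_M3d lam phi \<rho> \<alpha> n X \<partial>PiM {..<n} (\<lambda>_. P)) \<le>
    (real n ^ 2 * (S * (2 + 2 * B\<^sup>2 * N2)) + 2 * real n ^ 3 * (signal * (1 + B * sqrt S * sqrt N2))) / g\<^sup>2"
proof -
  let ?N = "PiM {..<n} (\<lambda>_. P)"
  define z where "z = std_normal_quantile (1 - \<alpha>)"
  define V where "V = (\<lambda>X. \<Sum>i<n. \<Sum>j<i. kern (X i) (X j))"
  define m where "m = real n * (real n - 1) / 2 * signal"
  interpret N: prob_space ?N
    by (intro prob_space_PiM) unfold_locales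
  note v = v_n_bounds[OF w]
  have kP: "case_prod kern \<in> borel_measurable (P \<Otimes>\<^sub>M P)" by measurable
  have kX: "(\<lambda>X. kern (X i) (X j)) \<in> borel_measurable ?N" if "i < n" "j < n" for i j
    using that by (intro measurable_compose[OF _ kP, of "\<lambda>X. (X i, X j)", simplified]) measurable
  have [measurable]: "V \<in> borel_measurable ?N"
    unfolding V_def by (intro borel_measurable_sum kX) auto
  have space_X: "X i \<in> space P0" if "X \<in> space ?N" "i < n" for X i
    using P.space_iidD[OF that] by (simp add: space_P)
  have bV: "\<bar>V X\<bar> \<le> real n * (real n * (S * B\<^sup>2))" if X: "X \<in> space ?N" for X
    unfolding V_def
  proof (intro abs_sum_le_real)
    fix i assume "i < n"
    then have "\<bar>\<Sum>j<i. kern (X i) (X j)\<bar> \<le> real i * (S * B\<^sup>2)"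
      by (intro abs_sum_le_real kern_bound space_X[OF X]) auto
    also have "\<dots> \<le> real n * (S * B\<^sup>2)"
      using \<open>i < n\<close> S_pos by (intro mult_right_mono) auto
    finally show "\<bar>\<Sum>j<i. kern (X i) (X j)\<bar> \<le> real n * (S * B\<^sup>2)" .
  qed
  have int: "integrable ?N (\<lambda>X. (V X - m)\<^sup>2)"
  proof (rule N.integrable_bounded)
    fix X assume "X \<in> space ?N"
    then have "\<bar>V X - m\<bar> \<le> real n * (real n * (S * B\<^sup>2)) + \<bar>m\<bar>"
      using bV[of X] by linarith
    then show "\<bar>(V X - m)\<^sup>2\<bar> \<le> (real n * (real n * (S * B\<^sup>2)) + \<bar>m\<bar>)\<^sup>2"
      by (rule abs_power2_le)
  qed measurable
  have pt: "1 - T_M3d lam phi \<rho> \<alpha> n X \<le> (V X - m)\<^sup>2 / g\<^sup>2" if X: "X \<in> space ?N" for X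
  proof (cases "1 / sqrt (2 * v_n lam \<rho>) * (real n * eta2 lam phi \<rho> n X - A_n lam phi \<rho> n X) > z")
    case True
    then show ?thesis by (simp add: T_M3d_def z_def)
  next
    case False
    have sv: "sqrt (2 * v_n lam \<rho>) > 0" using v by simp
    have "1 / sqrt (2 * v_n lam \<rho>) * (2 / real n * V X) \<le> z"
      using False statistic_eq[OF space_X[OF X] n w] unfolding V_def by simp
    then have "V X \<le> real n / 2 * (z * sqrt (2 * v_n lam \<rho>))"
      using sv n by (simp add: field_simps)
    \<comment> \<open>The quantile may be negative, so its absolute value is taken before
      \<open>v_n\<close> is enlarged to \<open>S\<close>.\<close>
    also have "\<dots> \<le> real n / 2 * (\<bar>z\<bar> * sqrt (2 * S))"
      using v by (intro mult_left_mono mult_mono) auto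
    finally have "g \<le> m - V X" using g(2) unfolding m_def z_def by linarith
    then have "g\<^sup>2 \<le> (m - V X)\<^sup>2" using g by (intro power_mono) auto
    then have "1 \<le> (V X - m)\<^sup>2 / g\<^sup>2" using g by (simp add: power2_commute)
    moreover have "1 - T_M3d lam phi \<rho> \<alpha> n X \<le> 1" by (simp add: T_M3d_def)
    ultimately show ?thesis by linarith
  qed
  have "(\<integral>X. 1 - T_M3d lam phi \<rho> \<alpha> n X \<partial>?N) \<le> (\<integral>X. (V X - m)\<^sup>2 / g\<^sup>2 \<partial>?N)"
    using int pt by (intro integral_mono') auto
  also have "\<dots> = (\<integral>X. (V X - m)\<^sup>2 \<partial>?N) / g\<^sup>2" by simp
  also have "\<dots> \<le> (real n ^ 2 * (S * (2 + 2 * B\<^sup>2 * N2)) + 2 * real n ^ 3 * (signal * (1 + B * sqrt S * sqrt N2))) / g\<^sup>2"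
    unfolding V_def m_def by (intro divide_right_mono expectation_U_kern_power2_le pos) auto
  finally show ?thesis .
qed

end

text \<open>Here \<open>n\<^sup>2 * N / 64\<close> is the gap left by the threshold, and
  \<open>8192 = 2 * 64\<^sup>2\<close>. With \<open>t = sqrt S\<close>, all terms but
  \<open>1 / (n * N)\<close> follow from \<open>t / (n * N) \<le> K / D\<close> and
  \<open>t / n \<le> K\<close>, the latter by \<open>r \<le> n\<close>; that one uses
  \<open>r \<ge> 1\<close>.\<close>

lemma error_bound:
  fixes n r S N \<Delta> B K D :: real
  assumes n: "n \<ge> 1" and r: "r \<ge> 1" "r \<le> n" and S: "S \<ge> 0" "sqrt S \<le> K * r"
    and N: "N \<ge> \<Delta>" "\<Delta> > 0" and D: "D = n * \<Delta> / r" and B: "B \<ge> 0" and K: "K \<ge> 0"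
  shows "(n ^ 2 * (S * (2 + 2 * B\<^sup>2 * N)) + 2 * n ^ 3 * (N * (1 + B * sqrt S * sqrt N))) / (n\<^sup>2 * N / 64)\<^sup>2
    \<le> 8192 * ((K / D)\<^sup>2 + B\<^sup>2 * (K\<^sup>2 / D) + 1 / D + B * (K / sqrt D))"
proof -
  have N0: "N > 0" using N by linarith
  have D0: "D > 0" using D n r N by simp
  define t where "t = sqrt S"
  define q where "q = sqrt N"
  have t: "t \<ge> 0" "t\<^sup>2 = S" "t \<le> K * r" and q: "q > 0" "q\<^sup>2 = N"
    using S N0 by (auto simp: t_def q_def)
  have x1: "t / (n * N) \<le> K / D"
  proof -
    have "t / (n * N) \<le> (K * r) / (n * \<Delta>)"
      using t n N N0 r K by (intro frac_le mult_left_mono) auto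
    also have "\<dots> = K / D" using D by simp
    finally show ?thesis .
  qed
  have x2: "t / n \<le> K"
  proof -
    have "t / n \<le> K * r / n" using t n by (intro divide_right_mono) auto
    also have "\<dots> \<le> K * n / n" using r n K by (intro divide_right_mono mult_left_mono) auto
    finally show ?thesis using n by simp
  qed
  have e1: "t\<^sup>2 / (n\<^sup>2 * N\<^sup>2) \<le> (K / D)\<^sup>2"
    using power_mono[OF x1, of 2] t n N0 by (simp add: power_divide power_mult_distrib)
  have e2: "t\<^sup>2 / (n\<^sup>2 * N) \<le> K\<^sup>2 / D"
  proof -
    have "t\<^sup>2 / (n\<^sup>2 * N) = (t / (n * N)) * (t / n)" by (simp add: power2_eq_square)
    also have "\<dots> \<le> (K / D) * K"
      using x1 x2 t n N0 K D0 by (intro mult_mono) auto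
    finally show ?thesis by (simp add: power2_eq_square)
  qed
  have e3: "1 / (n * N) \<le> 1 / D"
  proof -
    have "D \<le> n * \<Delta>" unfolding D using n N r by (simp add: divide_le_eq)
    also have "\<dots> \<le> n * N" using n N by (intro mult_left_mono) auto
    finally show ?thesis using D0 by (intro frac_le) auto
  qed
  have e4: "t / (n * q) \<le> K / sqrt D"
  proof -
    have "(t / (n * q))\<^sup>2 \<le> (K / sqrt D)\<^sup>2"
      using e2 D0 by (simp add: power_divide power_mult_distrib q)
    then show ?thesis by (rule power2_le_imp_le) (use K D0 in simp)
  qed
  have "(n ^ 2 * (S * (2 + 2 * B\<^sup>2 * N)) + 2 * n ^ 3 * (N * (1 + B * sqrt S * sqrt N))) / (n\<^sup>2 * N / 64)\<^sup>2
      = 8192 * (t\<^sup>2 / (n\<^sup>2 * N\<^sup>2) + B\<^sup>2 * (t\<^sup>2 / (n\<^sup>2 * N)) + 1 / (n * N) + B * (t / (n * q)))"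
  proof -
    let ?Z = "(n\<^sup>2 * N / 64)\<^sup>2"
    have Nq: "N = q * q" using q by (simp add: power2_eq_square)
    have "n\<^sup>2 * (t\<^sup>2 * 2) / ?Z = 8192 * (t\<^sup>2 / (n\<^sup>2 * N\<^sup>2))"
      using n N0 by (simp add: field_simps power2_eq_square)
    moreover have "n\<^sup>2 * (t\<^sup>2 * (2 * B\<^sup>2 * N)) / ?Z = 8192 * (B\<^sup>2 * (t\<^sup>2 / (n\<^sup>2 * N)))"
      using n N0 by (simp add: field_simps power2_eq_square)
    moreover have "2 * n ^ 3 * N / ?Z = 8192 * (1 / (n * N))"
      using n N0 by (simp add: field_simps power2_eq_square power3_eq_cube)
    moreover have "2 * n ^ 3 * (N * (B * t * q)) / ?Z = 8192 * (B * (t / (n * q)))"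
      using n q(1) by (simp add: Nq field_simps power2_eq_square power3_eq_cube)
    ultimately show ?thesis
      unfolding t_def[symmetric] q_def[symmetric] unfolding t(2)[symmetric]
      by (simp only: distrib_left add_divide_distrib mult_1_right add.assoc)
  qed
  also have "\<dots> \<le> 8192 * ((K / D)\<^sup>2 + B\<^sup>2 * (K\<^sup>2 / D) + 1 / D + B * (K / sqrt D))"
    using B by (intro mult_left_mono add_mono e1 e2 e3 e4) auto
  finally show ?thesis .
qed

text \<open>The limit superior controls \<open>lam k\<close> for large \<open>k\<close> only; the
  finitely many remaining values are absorbed into \<open>A\<close>. As \<open>2 * s > 1\<close>,
  the power bound also gives summability of \<open>lam\<close>.\<close>

lemma mercer_setupD:
  assumes "mercer_setup P0 K lam phi s"
  obtains A B where "mercer_system P0 phi B lam" "s > 1/2" "\<And>k. lam k > 0"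
    "\<And>k. lam k \<le> A * real (Suc k) powr (- (2 * s))"
proof -
  from assms have s: "s > 1/2" and pos: "\<And>k. lam k > 0"
    and P0: "prob_space P0"
    and lim: "Limsup sequentially (\<lambda>k. ereal (real (Suc k) powr (2 * s) * lam k)) < \<infinity>"
    unfolding mercer_setup_def by auto
  obtain B where B: "\<forall>k. \<forall>x\<in>space P0. \<bar>phi k x\<bar> \<le> B"
    using assms unfolding mercer_setup_def by auto
  define a where "a k = real (Suc k) powr (2 * s) * lam k" for k
  obtain b where "Limsup sequentially (\<lambda>k. ereal (a k)) < ereal b"
    using lim unfolding a_def by (metis ereal_dense2)
  then have "\<forall>\<^sub>F k in sequentially. a k < b"
    using Limsup_lessD[of sequentially "\<lambda>k. ereal (a k)" "ereal b"] by simp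
  then obtain k0 where k0: "\<And>k. k \<ge> k0 \<Longrightarrow> a k < b"
    unfolding eventually_sequentially by blast
  define A where "A = Max (insert b (a ` {..<k0}))"
  have aA: "a k \<le> A" for k
  proof (cases "k < k0")
    case True
    then show ?thesis unfolding A_def by (intro Max_ge) auto
  next
    case False
    then have "a k \<le> b" using k0[of k] by simp
    also have "b \<le> A" unfolding A_def by (intro Max_ge) auto
    finally show ?thesis .
  qed
  have le: "lam k \<le> A * real (Suc k) powr (- (2 * s))" for k
  proof -
    have "lam k = a k * real (Suc k) powr (- (2 * s))"
      unfolding a_def by (simp add: powr_minus)
    also have "\<dots> \<le> A * real (Suc k) powr (- (2 * s))"
      by (intro mult_right_mono aA) simp
    finally show ?thesis .
  qed
  have "summable (\<lambda>k. A * real (Suc k) powr (- (2 * s)))"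
    using s by (intro summable_mult) (simp add: summable_Suc_iff[of "\<lambda>k. real k powr (- (2 * s))"] summable_real_powr_iff del: of_nat_Suc)
  then have "summable lam"
    by (rule summable_comparison_test') (use le pos in \<open>auto simp: less_imp_le\<close>)
  moreover have "bounded_orthonormal P0 phi B"
    using assms B P0 unfolding mercer_setup_def L2_inner_def L2_def
    by (intro bounded_orthonormal.intro bounded_orthonormal_axioms.intro) auto
  ultimately have "mercer_system P0 phi B lam"
    using assms pos unfolding mercer_setup_def
    by (intro mercer_system.intro mercer_system_axioms.intro) auto
  with s pos le show ?thesis by (intro that)
qed

section \<open>Uniform error bound over the class of alternatives\<close>

context mercer_system
begin

text \<open>On a probability space a square-integrable \<open>u\<close> is integrable, hence so is
  \<open>f * u\<close> for bounded \<open>f\<close>. This allows the Radon-Nikodym formula to be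
  split into two integrals.\<close>

lemma density_alternative_Pclass:
  assumes P: "P \<in> Pclass P0 lam phi \<Delta> \<theta> M"
    and w: "\<And>k. 0 < w k" "\<And>k. w k \<le> 1" "summable w"
  shows "density_alternative P0 phi B P (\<lambda>x. enn2real (RN_deriv P0 P x) - 1) w"
proof -
  define u where "u = (\<lambda>x. enn2real (RN_deriv P0 P x) - 1)"
  have prob: "prob_space P" and sets: "sets P = sets P0" and ac: "absolutely_continuous P0 P"
    and uF: "u \<in> Fclass P0 lam phi \<theta> M"
    using P unfolding Pclass_def u_def Let_def by auto
  interpret P: prob_space P by fact
  have u: "u \<in> L2 P0"
    using uF by (auto simp: Fclass_def in_RKHS_def split: if_splits)
  have [measurable]: "u \<in> borel_measurable P0" using u by (simp add: L2_def)
  have one_L2: "(\<lambda>x. 1) \<in> L2 P0" by (simp add: L2_def)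
  have iu: "integrable P0 u"
    using integrable_L2_mult[OF u one_L2] by simp
  show ?thesis
    unfolding u_def[symmetric]
  proof (intro density_alternative.intro density_alternative_axioms.intro bounded_orthonormal_axioms prob sets u w)
    fix f :: "'a \<Rightarrow> real" and C
    assume f[measurable]: "f \<in> borel_measurable P0" and bf: "\<And>x. x \<in> space P0 \<Longrightarrow> \<bar>f x\<bar> \<le> C"
    have ifu: "integrable P0 (\<lambda>x. f x * u x)"
    proof (rule Bochner_Integration.integrable_bound)
      show "integrable P0 (\<lambda>x. C * u x)" using iu by simp
      show "AE x in P0. norm (f x * u x) \<le> norm (C * u x)"
        using bf by (intro AE_I2) (auto simp: abs_mult intro!: mult_right_mono order_trans[OF bf])
    qed measurable
    have "(\<integral>x. f x \<partial>P) = (\<integral>x. enn2real (RN_deriv P0 P x) * f x \<partial>P0)"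
      by (intro RN_deriv_integral ac sets f) unfold_locales
    also have "\<dots> = (\<integral>x. f x + f x * u x \<partial>P0)"
      by (simp add: u_def algebra_simps)
    also have "\<dots> = (\<integral>x. f x \<partial>P0) + (\<integral>x. f x * u x \<partial>P0)"
      using ifu integrable_bounded[OF f bf] by simp
    finally show "(\<integral>x. f x \<partial>P) = (\<integral>x. f x \<partial>P0) + (\<integral>x. f x * u x \<partial>P0)" .
  qed
qed

text \<open>For \<open>\<theta> = 0\<close> the function \<open>u\<close> approximates itself with
  norm at most \<open>M\<close>. Otherwise the radius is tuned to the size of \<open>u\<close>, and
  \<open>large\<close> says precisely that this radius satisfies the smoothness condition of
  \<open>weighted_coef_sum_ge\<close>.\<close>

lemma signal_ge_Fclass:
  assumes u: "u \<in> Fclass P0 lam phi \<theta> M" and \<theta>: "\<theta> \<ge> 0" and M: "M > 0" and \<rho>: "\<rho> > 0"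
    and pos: "(\<integral>x. (u x)\<^sup>2 \<partial>P0) > 0"
    and large: "16 * \<rho>\<^sup>2 * (if \<theta> = 0 then M else (4 * M) powr \<theta>)\<^sup>2 \<le> (\<integral>x. (u x)\<^sup>2 \<partial>P0) powr (\<theta> + 1)"
  shows "(\<integral>x. (u x)\<^sup>2 \<partial>P0) / 8 \<le> (\<Sum>k. lam k / (lam k + \<rho>\<^sup>2) * (L2_inner P0 u (phi k))\<^sup>2)"
proof -
  let ?N = "\<integral>x. (u x)\<^sup>2 \<partial>P0"
  have u2: "u \<in> L2 P0"
    using u by (auto simp: Fclass_def in_RKHS_def split: if_splits)
  have "\<exists>f. in_RKHS P0 lam phi f \<and> (\<integral>x. (u x - f x)\<^sup>2 \<partial>P0) \<le> ?N / 16 \<and>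
      \<rho>\<^sup>2 * (RKHS_norm P0 lam phi f)\<^sup>2 \<le> ?N / 16"
  proof (cases "\<theta> = 0")
    case True
    then have "in_RKHS P0 lam phi u" "RKHS_norm P0 lam phi u \<le> M"
      using u by (auto simp: Fclass_def)
    moreover have "0 \<le> RKHS_norm P0 lam phi u"
      using \<open>in_RKHS P0 lam phi u\<close> lam_pos unfolding RKHS_norm_def in_RKHS_def
      by (auto intro!: suminf_nonneg simp: less_imp_le)
    ultimately have "\<rho>\<^sup>2 * (RKHS_norm P0 lam phi u)\<^sup>2 \<le> \<rho>\<^sup>2 * M\<^sup>2"
      by (intro mult_left_mono power_mono) auto
    also have "\<dots> \<le> ?N / 16" using large True pos by simp
    finally show ?thesis using \<open>in_RKHS P0 lam phi u\<close> pos by (intro exI[of _ u]) simp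
  next
    case False
    then have \<theta>0: "\<theta> > 0" using \<theta> by simp
    define q where "q = sqrt ?N"
    have q: "q > 0" "q\<^sup>2 = ?N" using pos by (auto simp: q_def)
    \<comment> \<open>This radius makes the guaranteed approximation error
      \<open>M * R powr (-1/\<theta>)\<close> equal to \<open>q / 4\<close>, a quarter of the norm
      of \<open>u\<close>.\<close>
    define R where "R = (4 * M / q) powr \<theta>"
    have R0: "R > 0" using M q by (simp add: R_def)
    obtain f where f: "in_RKHS P0 lam phi f" "RKHS_norm P0 lam phi f \<le> R"
      "L2_norm P0 (\<lambda>x. u x - f x) \<le> M * R powr (-1/\<theta>)"
      using u R0 False unfolding Fclass_def by auto
    have "M * R powr (-1/\<theta>) = q / 4"
      unfolding R_def powr_powr using \<theta>0 M q by (simp add: powr_minus)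
    with f(3) have "L2_norm P0 (\<lambda>x. u x - f x) \<le> q / 4" by simp
    then have "(\<integral>x. (u x - f x)\<^sup>2 \<partial>P0) \<le> (q / 4)\<^sup>2"
      unfolding L2_norm_def by (rule sqrt_le_D)
    then have 1: "(\<integral>x. (u x - f x)\<^sup>2 \<partial>P0) \<le> ?N / 16"
      using q by (simp add: power_divide)
    have "0 \<le> RKHS_norm P0 lam phi f"
      using f(1) lam_pos unfolding RKHS_norm_def in_RKHS_def
      by (auto intro!: suminf_nonneg simp: less_imp_le)
    then have "\<rho>\<^sup>2 * (RKHS_norm P0 lam phi f)\<^sup>2 \<le> \<rho>\<^sup>2 * R\<^sup>2"
      using f(2) by (intro mult_left_mono power_mono) auto
    also have "R\<^sup>2 = ((4 * M) powr \<theta>)\<^sup>2 / ?N powr \<theta>"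
    proof -
      have "(q powr \<theta>)\<^sup>2 = (q\<^sup>2) powr \<theta>"
        using q(1) by (simp add: powr_mult power2_eq_square)
      then show ?thesis
        unfolding R_def using M q by (simp add: powr_divide power_divide)
    qed
    also have "\<rho>\<^sup>2 * (((4 * M) powr \<theta>)\<^sup>2 / ?N powr \<theta>) \<le> ?N / 16"
      using large False pos by (simp add: powr_add field_simps)
    finally show ?thesis using f(1) 1 by blast
  qed
  then obtain f where f: "in_RKHS P0 lam phi f" "(\<integral>x. (u x - f x)\<^sup>2 \<partial>P0) \<le> ?N / 16"
    "\<rho>\<^sup>2 * (RKHS_norm P0 lam phi f)\<^sup>2 \<le> ?N / 16" by blast
  have "0 \<le> (\<Sum>k. (L2_inner P0 f (phi k))\<^sup>2 / lam k)"
    using f(1) lam_pos unfolding in_RKHS_def by (intro suminf_nonneg) (auto simp: less_imp_le)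
  then have "\<rho>\<^sup>2 * (\<Sum>k. (L2_inner P0 f (phi k))\<^sup>2 / lam k) \<le> ?N / 16"
    using f(3) unfolding RKHS_norm_def by simp
  from weighted_coef_sum_ge[OF u2 f(1) \<rho> f(2) this] show ?thesis .
qed

text \<open>The bound depends on the alternative only through \<open>\<Delta>\<close>, so it
  survives the supremum. \<open>thr\<close> keeps the rejection threshold below half of the
  guaranteed mean, and \<open>large\<close> keeps the smoothing bias under control.\<close>

lemma typeII_le:
  fixes \<theta> K r D :: real
  assumes \<theta>: "\<theta> \<ge> 0" and M: "M > 0" and \<rho>: "0 < \<rho>"
    and n: "n \<ge> 2" and \<Delta>: "\<Delta> > 0" and r: "r \<ge> 1" "r \<le> real n"
    and S: "summable (\<lambda>k. lam k / (lam k + \<rho>\<^sup>2))" "sqrt (\<Sum>k. lam k / (lam k + \<rho>\<^sup>2)) \<le> K * r"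
    and D: "D = real n * \<Delta> / r"
    and large: "16 * \<rho>\<^sup>2 * (if \<theta> = 0 then M else (4 * M) powr \<theta>)\<^sup>2 \<le> \<Delta> powr (\<theta> + 1)"
    and thr: "\<bar>std_normal_quantile (1 - \<alpha>)\<bar> * sqrt 2 * K \<le> D / 32"
  shows "\<bar>typeII P0 lam phi n (T_M3d lam phi \<rho> \<alpha> n) \<Delta> \<theta> M\<bar>
    \<le> 8192 * ((K / D)\<^sup>2 + B\<^sup>2 * (K\<^sup>2 / D) + 1 / D + B * (K / sqrt D))"
    (is "_ \<le> ?E")
proof -
  define w where "w k = lam k / (lam k + \<rho>\<^sup>2)" for k
  define z where "z = std_normal_quantile (1 - \<alpha>)"
  let ?T = "T_M3d lam phi \<rho> \<alpha> n"
  have den: "lam k + \<rho>\<^sup>2 > 0" for k using lam_pos[of k] \<rho> by (intro add_pos_pos) auto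
  have w: "\<And>k. 0 < w k" "\<And>k. w k \<le> 1" "summable w"
    using lam_pos den \<rho> S(1) by (auto simp: w_def[abs_def])
  have S0: "suminf w > 0" by (intro suminf_pos w)
  have K: "K \<ge> 0"
  proof (rule ccontr)
    assume "\<not> K \<ge> 0"
    then have "K * r < 0" using r by (simp add: mult_neg_pos)
    then show False using S(2) S0 unfolding w_def[abs_def, symmetric] by (smt (verit) real_sqrt_gt_zero)
  qed
  have D0: "D > 0" using D n r \<Delta> by simp
  have E0: "0 \<le> ?E" using K D0 B_nonneg by simp
  have bound: "(\<integral>X. 1 - ?T X \<partial>PiM {..<n} (\<lambda>_. P)) \<le> ?E" if P: "P \<in> Pclass P0 lam phi \<Delta> \<theta> M" for P
  proof -
    define u where "u = (\<lambda>x. enn2real (RN_deriv P0 P x) - 1)"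
    interpret density_alternative P0 phi B P u w
      unfolding u_def by (rule density_alternative_Pclass[OF P w])
    have uF: "u \<in> Fclass P0 lam phi \<theta> M" and "(L2_norm P0 u)\<^sup>2 \<ge> \<Delta>"
      using P unfolding Pclass_def u_def Let_def by auto
    then have N: "N2 \<ge> \<Delta>" unfolding L2_norm_def by simp
    then have N0: "N2 > 0" using \<Delta> by linarith
    have "N2 / 8 \<le> signal"
      unfolding signal_def coef_def w_def
    proof (rule signal_ge_Fclass[OF uF \<theta> M \<rho> N0])
      have "\<Delta> powr (\<theta> + 1) \<le> N2 powr (\<theta> + 1)"
        using \<Delta> N \<theta> by (intro powr_mono2) auto
      then show "16 * \<rho>\<^sup>2 * (if \<theta> = 0 then M else (4 * M) powr \<theta>)\<^sup>2 \<le> N2 powr (\<theta> + 1)"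
        using large by linarith
    qed
    note sig = this
    then have sig0: "signal > 0" using N0 by linarith
    have sS: "sqrt S \<le> K * r" using S(2) by (simp add: w_def[abs_def])
    let ?n = "real n"
    have n2: "?n \<ge> 2" using n by simp
    have "\<bar>z\<bar> * sqrt (2 * S) \<le> \<bar>z\<bar> * sqrt 2 * (K * r)"
      unfolding real_sqrt_mult mult.assoc by (intro mult_left_mono sS) auto
    also have "\<dots> \<le> D / 32 * r"
      using mult_right_mono[OF thr, of r] r by (simp add: z_def mult.assoc)
    also have "\<dots> = ?n * \<Delta> / 32" using D r by simp
    also have "\<dots> \<le> ?n * N2 / 32" using N by (intro divide_right_mono mult_left_mono) auto
    finally have thr_le: "?n / 2 * (\<bar>z\<bar> * sqrt (2 * S)) \<le> ?n / 2 * (?n * N2 / 32)"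
      by (intro mult_left_mono) auto
    \<comment> \<open>Since \<open>n \<ge> 2\<close>, the factor \<open>n - 1\<close> is at least
      \<open>n / 2\<close>.\<close>
    have mean_ge: "?n\<^sup>2 / 4 * (N2 / 8) \<le> ?n * (?n - 1) / 2 * signal"
      using sig N0 n2 by (intro mult_mono) (auto simp: power2_eq_square field_simps)
    \<comment> \<open>The mean is at least \<open>n\<^sup>2 * N2 / 32\<close> and the threshold
      takes at most half of that; the other half is the gap for Chebyshev's inequality.\<close>
    have gap: "?n\<^sup>2 * N2 / 64 + ?n / 2 * (\<bar>z\<bar> * sqrt (2 * S)) \<le> ?n * (?n - 1) / 2 * signal"
    proof -
      have "?n / 2 * (?n * N2 / 32) = ?n\<^sup>2 * N2 / 64" "?n\<^sup>2 / 4 * (N2 / 8) = ?n\<^sup>2 * N2 / 32"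
        by (simp_all add: power2_eq_square)
      then show ?thesis using thr_le mean_ge by linarith
    qed
    have "(\<integral>X. 1 - ?T X \<partial>PiM {..<n} (\<lambda>_. P)) \<le>
      (?n ^ 2 * (S * (2 + 2 * B\<^sup>2 * N2)) + 2 * ?n ^ 3 * (signal * (1 + B * sqrt S * sqrt N2))) / (?n\<^sup>2 * N2 / 64)\<^sup>2"
      using n N0 gap sig0 by (intro chebyshev_typeII) (auto simp: w_def z_def)
    also have "\<dots> \<le> (?n ^ 2 * (S * (2 + 2 * B\<^sup>2 * N2)) + 2 * ?n ^ 3 * (N2 * (1 + B * sqrt S * sqrt N2))) / (?n\<^sup>2 * N2 / 64)\<^sup>2"
      using signal_le B_nonneg S0 N0
      by (intro divide_right_mono add_left_mono mult_left_mono mult_right_mono) auto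
    also have "\<dots> \<le> ?E"
      using n2 S0 by (intro error_bound[OF _ r _ sS N \<Delta> D B_nonneg K]) auto
    finally show ?thesis .
  qed
  have nonneg: "0 \<le> (\<integral>X. 1 - ?T X \<partial>PiM {..<n} (\<lambda>_. P))" for P
    by (intro Bochner_Integration.integral_nonneg) (simp add: T_M3d_def)
  show ?thesis
  proof (cases "Pclass P0 lam phi \<Delta> \<theta> M = {}")
    case True
    then show ?thesis using E0 by (simp add: typeII_def)
  next
    case False
    let ?I = "\<lambda>P. \<integral>X. 1 - ?T X \<partial>PiM {..<n} (\<lambda>_. P)"
    from False obtain P where P: "P \<in> Pclass P0 lam phi \<Delta> \<theta> M" by blast
    \<comment> \<open>A supremum of reals dominates its members only when the set is bounded above;
      this yields the lower bound 0 needed for the absolute value.\<close>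
    have "bdd_above (?I ` Pclass P0 lam phi \<Delta> \<theta> M)"
      using bound by (intro bdd_aboveI[of _ ?E]) auto
    from cSUP_upper[OF P this] nonneg[of P]
    have "0 \<le> (SUP P\<in>Pclass P0 lam phi \<Delta> \<theta> M. ?I P)" by linarith
    moreover have "(SUP P\<in>Pclass P0 lam phi \<Delta> \<theta> M. ?I P) \<le> ?E"
      by (rule cSUP_least[OF False bound])
    ultimately show ?thesis using False by (simp add: typeII_def)
  qed
qed

end

theorem theorem3:
  fixes P0 :: "'a measure" and K :: "'a \<Rightarrow> 'a \<Rightarrow> real"
    and lam :: "nat \<Rightarrow> real" and phi :: "nat \<Rightarrow> 'a \<Rightarrow> real"
    and s \<theta> M \<alpha> c :: real and \<Delta> \<rho> :: "nat \<Rightarrow> real"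
  assumes mercer: "mercer_setup P0 K lam phi s"
    and theta: "\<theta> \<ge> 0" and M: "M > 0" and alpha: "0 < \<alpha>" "\<alpha> < 1" and c: "c > 0"
    and rho: "\<And>n. \<rho> n = c * real n powr (- (2 * s * (\<theta> + 1) / (4 * s + \<theta> + 1)))"
    and Delta: "filterlim (\<lambda>n. real n powr (4 * s / (4 * s + \<theta> + 1)) * \<Delta> n) at_top sequentially"
  shows "(\<lambda>n. typeII P0 lam phi n (T_M3d lam phi (\<rho> n) \<alpha> n) (\<Delta> n) \<theta> M) \<longlonglongrightarrow> 0"
proof -
  obtain A B where ms: "mercer_system P0 phi B lam" and s: "s > 1/2" and lam_pos: "\<And>k. lam k > 0"
    and lam_le: "\<And>k. lam k \<le> A * real (Suc k) powr (- (2 * s))"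
    using mercer_setupD[OF mercer] by metis
  interpret mercer_system P0 phi B lam by fact
  define E where "E = 4 * s + \<theta> + 1"
  have E: "E > 0" using s theta by (simp add: E_def)
  define D where "D n = real n powr (4 * s / E) * \<Delta> n" for n
  \<comment> \<open>The order of \<open>sqrt S\<close>: by the choice of \<open>\<rho>\<close>, the
    bound \<open>\<rho> n powr (-1/s)\<close> on the effective dimension is a constant times
    \<open>(r n)\<^sup>2\<close>.\<close>
  define r where "r n = real n powr ((\<theta> + 1) / E)" for n
  \<comment> \<open>The approximant of \<open>u\<close> has RKHS norm at most \<open>Q\<close>
    divided by the norm of \<open>u\<close> to the power \<theta>. The case split is needed because
    \<open>(4 * M) powr 0\<close> would lose \<open>M\<close>.\<close>
  define Q where "Q = (if \<theta> = 0 then M else (4 * M) powr \<theta>)"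
  define C where "C = 1 + c powr (1/s) + A / (2 * s - 1)"
  define L where "L = sqrt (C * c powr (-1/s))"
  define z where "z = \<bar>std_normal_quantile (1 - \<alpha>)\<bar> * sqrt 2 * L"
  have Dlim: "filterlim D at_top sequentially"
    using Delta unfolding D_def E_def .
  have A0: "A \<ge> 0" using lam_le[of 0] lam_pos[of 0] by simp
  have C0: "C \<ge> 0" using A0 s by (simp add: C_def)
  have L0: "L \<ge> 0" using C0 by (simp add: L_def)
  have powr_sq: "(x powr a)\<^sup>2 = x powr (2 * a)" for x a :: real
    unfolding power2_eq_square mult_2 powr_add ..
  have ev: "\<forall>\<^sub>F n in sequentially. n \<ge> 2 \<and> D n \<ge> 1 \<and> D n \<ge> 16 * c\<^sup>2 * Q\<^sup>2 \<and> D n \<ge> 32 * z"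
    using Dlim unfolding filterlim_at_top by (intro eventually_conj eventually_ge_at_top) auto
  have "\<forall>\<^sub>F n in sequentially. norm (typeII P0 lam phi n (T_M3d lam phi (\<rho> n) \<alpha> n) (\<Delta> n) \<theta> M)
      \<le> 8192 * ((L / D n)\<^sup>2 + B\<^sup>2 * (L\<^sup>2 / D n) + 1 / D n + B * (L / sqrt (D n)))"
    using ev
  proof eventually_elim
    case (elim n)
    then have n: "n \<ge> 2" "real n \<ge> 1" and D1: "D n \<ge> 1" "D n \<ge> 16 * c\<^sup>2 * Q\<^sup>2" "D n \<ge> 32 * z" by auto
    have rho0: "\<rho> n > 0" using c n by (simp add: rho)
    have rho_c: "\<rho> n \<le> c"
    proof -
      have "real n powr (- (2 * s * (\<theta> + 1) / E)) \<le> real n powr 0"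
        using n s theta E by (intro powr_mono) auto
      then show ?thesis using c n unfolding rho E_def[symmetric] by simp
    qed
    have r1: "r n \<ge> 1"
      unfolding r_def using n theta E by (intro ge_one_powr_ge_zero) auto
    have rn: "r n \<le> real n"
    proof -
      have "r n \<le> real n powr 1"
        unfolding r_def using n s theta E by (intro powr_mono) (auto simp: E_def)
      then show ?thesis using n by simp
    qed
    have \<Delta>_eq: "\<Delta> n = D n * real n powr (- (4 * s / E))"
      unfolding D_def using n by (simp add: powr_minus)
    have \<Delta>0: "\<Delta> n > 0" unfolding \<Delta>_eq using D1 n by simp
    have Dn: "D n = real n * \<Delta> n / r n"
    proof -
      have "4 * s / E = 1 - (\<theta> + 1) / E"
        using E unfolding E_def by (simp add: field_simps)
      then have "real n powr (4 * s / E) = real n / r n"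
        using n unfolding r_def by (simp add: powr_diff)
      then show ?thesis by (simp add: D_def)
    qed
    note S = effective_dimension_le[OF s lam_pos lam_le rho0 rho_c, folded C_def]
    have "\<rho> n powr (-1/s) = c powr (-1/s) * (r n)\<^sup>2"
    proof -
      have "(r n)\<^sup>2 = real n powr (2 * ((\<theta> + 1) / E))"
        unfolding r_def by (rule powr_sq)
      moreover have "- (2 * s * (\<theta> + 1) / E) * (-1/s) = 2 * ((\<theta> + 1) / E)"
        using s by simp
      ultimately show ?thesis
        unfolding rho E_def[symmetric] using c n by (simp add: powr_mult powr_powr)
    qed
    with S(2) have "(\<Sum>k. lam k / (lam k + (\<rho> n)\<^sup>2)) \<le> C * c powr (-1/s) * (r n)\<^sup>2"
      by (simp add: mult.assoc)
    then have "sqrt (\<Sum>k. lam k / (lam k + (\<rho> n)\<^sup>2)) \<le> sqrt (C * c powr (-1/s) * (r n)\<^sup>2)"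
      by (rule real_sqrt_le_mono)
    also have "\<dots> = L * r n"
      using r1 unfolding L_def by (simp add: real_sqrt_mult)
    finally have sS: "sqrt (\<Sum>k. lam k / (lam k + (\<rho> n)\<^sup>2)) \<le> L * r n" .
    \<comment> \<open>The powers of \<open>n\<close> in \<open>(\<rho> n)\<^sup>2\<close> and in
      \<open>\<Delta> n powr (\<theta> + 1)\<close> coincide, so the condition reduces to
      \<open>16 * c\<^sup>2 * Q\<^sup>2 \<le> D n powr (\<theta> + 1)\<close>. As
      \<open>D n \<ge> 1\<close> and \<open>\<theta> \<ge> 0\<close>, a lower bound on
      \<open>D n\<close> itself suffices.\<close>
    have "16 * (\<rho> n)\<^sup>2 * Q\<^sup>2 \<le> \<Delta> n powr (\<theta> + 1)"
    proof -
      have "(\<rho> n)\<^sup>2 = c\<^sup>2 * real n powr (- (4 * s / E) * (\<theta> + 1))"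
      proof -
        have "(real n powr (- (2 * s * (\<theta> + 1) / E)))\<^sup>2 = real n powr (2 * (- (2 * s * (\<theta> + 1) / E)))"
          by (rule powr_sq)
        also have "2 * (- (2 * s * (\<theta> + 1) / E)) = - (4 * s / E) * (\<theta> + 1)" by simp
        finally show ?thesis unfolding rho E_def[symmetric] power_mult_distrib by simp
      qed
      then have "16 * (\<rho> n)\<^sup>2 * Q\<^sup>2 = 16 * c\<^sup>2 * Q\<^sup>2 * real n powr (- (4 * s / E) * (\<theta> + 1))"
        by simp
      also have "\<dots> \<le> D n powr (\<theta> + 1) * real n powr (- (4 * s / E) * (\<theta> + 1))"
      proof (intro mult_right_mono)
        have "D n powr 1 \<le> D n powr (\<theta> + 1)" using D1 theta by (intro powr_mono) auto
        then show "16 * c\<^sup>2 * Q\<^sup>2 \<le> D n powr (\<theta> + 1)" using D1 by simp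
      qed simp
      also have "\<dots> = \<Delta> n powr (\<theta> + 1)"
        unfolding \<Delta>_eq using D1 n by (simp add: powr_mult powr_powr)
      finally show ?thesis .
    qed
    then show ?case
      unfolding real_norm_def using D1(3)
      by (intro typeII_le[OF theta M rho0 n(1) \<Delta>0 r1 rn S(1) sS Dn])
        (auto simp: Q_def z_def)
  qed
  moreover have "(\<lambda>n. 8192 * ((L / D n)\<^sup>2 + B\<^sup>2 * (L\<^sup>2 / D n) + 1 / D n + B * (L / sqrt (D n)))) \<longlonglongrightarrow> 0"
  proof -
    have 1: "(\<lambda>n. a / D n) \<longlonglongrightarrow> 0" for a
      using Dlim by (intro tendsto_divide_0[OF tendsto_const] filterlim_at_top_imp_at_infinity)
    have 2: "(\<lambda>n. L / sqrt (D n)) \<longlonglongrightarrow> 0"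
      by (intro tendsto_divide_0[OF tendsto_const] filterlim_at_top_imp_at_infinity
          filterlim_compose[OF sqrt_at_top Dlim])
    have "(\<lambda>n. 8192 * ((L / D n)\<^sup>2 + B\<^sup>2 * (L\<^sup>2 / D n) + 1 / D n + B * (L / sqrt (D n))))
        \<longlonglongrightarrow> 8192 * (0\<^sup>2 + B\<^sup>2 * 0 + 0 + B * 0)"
      by (intro tendsto_intros 1 2)
    then show ?thesis by simp
  qed
  ultimately show ?thesis
    by (rule Lim_null_comparison)
qed

end
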